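(* Let $\mathbf{t}$ be an episturmian word over a finite alphabet $\mathcal{A}$. The set of quasiperiods of $\mathbf{t}$ is exactly the set of all words \[ \mu_{\breve w}(Pal(v))\,p, \qquad p \text{ a prefix of } S_{\breve w}^{-1}Pal(w), \] where $w, v\in\mathcal{A}^*$ are (L-spinned) words such that $\mathbf{t}$ is directed by $\breve w v \breve{\mathbf{y}}$ for some spinned version $\breve w$ of $w$ and some spinned version $\breve{\mathbf{y}}$ of an infinite word $\mathbf{y}\in\mathcal{A}^\omega$ with $\mathrm{Alph}(v)=\mathrm{Alph}(v\mathbf{y})$. Moreover, the smallest (shortest) quasiperiod of $\mathbf{t}$ is the word $\mu_{\breve w}(Pal(v))$ for such $w,\breve w,v,\mathbf{y},\breve{\mathbf{y}}$ in which $wv$ is of minimal length for the property $\mathrm{Alph}(wv)=\mathrm{Alph}(wv\mathbf{y})$, and, amongst all decompositions of $wv$ into $w$ and $v$, the word $v$ is the shortest suffix of $wv$ such that $\mathrm{Alph}(v)=\mathrm{Alph}(v\mathbf{y})$.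
   Context: $\mathcal{A}$ is a finite alphabet; $\mathrm{Alph}(u)$ is the set of letters occurring in a finite or infinite word $u$. For $a\in\mathcal{A}$, $L_a$ and $R_a$ are the morphisms of $\mathcal{A}^*$ with $L_a(a)=R_a(a)=a$ and $L_a(b)=ab$, $R_a(b)=ba$ for $b\neq a$ (extended letterwise to infinite words). Let $\bar{\mathcal A}=\{\bar x: x\in\mathcal{A}\}$ be a disjoint copy of $\mathcal A$; letters of $\mathcal A$ have spin $L$, letters of $\bar{\mathcal A}$ spin $R$; words over $\mathcal A\cup\bar{\mathcal A}$ are spinned words. A spinned version of $w=x_1\cdots x_n\in\mathcal A^*$ is any word $\breve x_1\cdots\breve x_n$ with $\breve x_i\in\{x_i,\bar x_i\}$ (similarly for infinite words). Put $\mu_a=L_a$, $\mu_{\bar a}=R_a$, $\mu_{\breve x_1\cdots\breve x_n}=\mu_{\breve x_1}\circ\cdots\circ\mu_{\breve x_n}$, $\mu_\varepsilon=\mathrm{id}$. An infinite word is episturmian if its set of factors is closed under reversal and it has at most one right special factor of each length ($u$ is right special if $ua,ub$ are factors for distinct letters $a,b$). A spinned infinite word $\breve x_1\breve x_2\cdots$ directs $\mathbf t$ (is a directive word of $\mathbf t$) if there are recurrent infinite words $\mathbf t^{(n)}$, $n\ge0$, with $\mathbf t^{(0)}=\mathbf t$ and $\mathbf t^{(n-1)}=\mu_{\breve x_n}(\mathbf t^{(n)})$ for all $n\ge1$. $Pal$ is the iterated palindromic closure: $Pal(\varepsilon)=\varepsilon$ and $Pal(wx)$ is the shortest palindrome having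 $Pal(w)x$ as a prefix ($x$ a letter). For a spinned version $\breve w=\breve x_1\cdots\breve x_n$ of $w=x_1\cdots x_n\in\mathcal A^*$, the shifting factor is $S_{\breve w}=\prod \mu_{x_1\cdots x_{i-1}}(x_i)$, the product (concatenation) taken over the indices $i$ with $\breve x_i=\bar x_i$ in decreasing order $i=n,\dots,1$; it is a prefix of $Pal(w)$. A finite word $u$ is a quasiperiod of an infinite word $\mathbf w$ if there exist words $(p_n)_{n\ge0}$ with $p_0=\varepsilon$, $|p_n|<|p_{n+1}|\le|p_nu|$ and $p_nu$ a prefix of $\mathbf w$ for all $n$; $\mathbf w$ is quasiperiodic if it has a quasiperiod. *)

theory Defs
  imports Main "HOL-Library.Stream" "HOL-Library.Sublist"
begin

text \<open>
  Finite words are lists and infinite words are streams. The finite alphabet is the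
  carrier of a type of class \<^class>\<open>finite\<close>; \<open>Alph(u)\<close> is
  \<^term>\<open>set u\<close> for finite and \<^term>\<open>sset u\<close> for infinite \<open>u\<close>.
\<close>

datatype 'a spinned = Spin_L (base: 'a) | is_R: Spin_R (base: 'a)

definition spinned_version :: "'a spinned list \<Rightarrow> 'a list \<Rightarrow> bool" where
  "spinned_version ws w \<longleftrightarrow> map base ws = w"

definition spinned_version_inf :: "'a spinned stream \<Rightarrow> 'a stream \<Rightarrow> bool" where
  "spinned_version_inf ys y \<longleftrightarrow> smap base ys = y"

abbreviation L_spinned :: "'a list \<Rightarrow> 'a spinned list" where
  "L_spinned w \<equiv> map Spin_L w"

subsection \<open>The morphisms\<close>

definition L_morph :: "'a \<Rightarrow> 'a \<Rightarrow> 'a list" where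
  "L_morph a b = (if b = a then [a] else [a, b])"

definition R_morph :: "'a \<Rightarrow> 'a \<Rightarrow> 'a list" where
  "R_morph a b = (if b = a then [a] else [b, a])"

fun mu_letter :: "'a spinned \<Rightarrow> 'a \<Rightarrow> 'a list" where
  "mu_letter (Spin_L a) = L_morph a"
| "mu_letter (Spin_R a) = R_morph a"

definition extend :: "('a \<Rightarrow> 'b list) \<Rightarrow> 'a list \<Rightarrow> 'b list" where
  "extend f u = concat (map f u)"

text \<open>
  \<^const>\<open>flat\<close> concatenates a stream of words correctly only if they are all
  nonempty, which is the case for the images of letters under \<open>mu_letter\<close>.
\<close>

definition extend_inf :: "('a \<Rightarrow> 'b list) \<Rightarrow> 'a stream \<Rightarrow> 'b stream" where
  "extend_inf f t = flat (smap f t)"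

primrec mu :: "'a spinned list \<Rightarrow> 'a list \<Rightarrow> 'a list" where
  "mu [] = id"
| "mu (x # xs) = extend (mu_letter x) \<circ> mu xs"

subsection \<open>Factors, recurrence, episturmian words\<close>

definition occurs_at :: "'a list \<Rightarrow> 'a stream \<Rightarrow> nat \<Rightarrow> bool" where
  "occurs_at u t i \<longleftrightarrow> stake (length u) (sdrop i t) = u"

definition factor :: "'a list \<Rightarrow> 'a stream \<Rightarrow> bool" where
  "factor u t \<longleftrightarrow> (\<exists>i. occurs_at u t i)"

definition recurrent :: "'a stream \<Rightarrow> bool" where
  "recurrent t \<longleftrightarrow> (\<forall>u. factor u t \<longrightarrow> infinite {i. occurs_at u t i})"

definition right_special :: "'a list \<Rightarrow> 'a stream \<Rightarrow> bool" where
  "right_special u t \<longleftrightarrow> (\<exists>a b. a \<noteq> b \<and> factor (u @ [a]) t \<and> factor (u @ [b]) t)"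

definition episturmian :: "'a stream \<Rightarrow> bool" where
  "episturmian t \<longleftrightarrow>
     (\<forall>u. factor u t \<longrightarrow> factor (rev u) t) \<and>
     (\<forall>n. \<exists>\<^sub>\<le>\<^sub>1 u. length u = n \<and> right_special u t)"

definition directs :: "'a spinned stream \<Rightarrow> 'a stream \<Rightarrow> bool" where
  "directs \<Delta> t \<longleftrightarrow>
     (\<exists>T :: nat \<Rightarrow> 'a stream. T 0 = t \<and> (\<forall>n. recurrent (T n)) \<and>
        (\<forall>n. T n = extend_inf (mu_letter (\<Delta> !! n)) (T (Suc n))))"

subsection \<open>Palindromic closure and shifting factors\<close>

definition palindrome :: "'a list \<Rightarrow> bool" where
  "palindrome u \<longleftrightarrow> rev u = u"

text \<open>
  A palindrome beginning with \<open>u\<close> and of length at most \<open>2 * length u\<close> is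
  determined by its length, so for nonempty \<open>u\<close> the shortest one is unique.
\<close>

definition pal_closure :: "'a list \<Rightarrow> 'a list" where
  "pal_closure u = (ARG_MIN length p. palindrome p \<and> prefix u p)"

definition Pal :: "'a list \<Rightarrow> 'a list" where
  "Pal w = foldl (\<lambda>u x. pal_closure (u @ [x])) [] w"

definition shifting_factor :: "'a spinned list \<Rightarrow> 'a list" where
  "shifting_factor ws =
     concat (map (\<lambda>i. mu (L_spinned (map base (take i ws))) [base (ws ! i)])
       (filter (\<lambda>i. is_R (ws ! i)) (rev [0..<length ws])))"

text \<open>\<open>u\<inverse>v\<close>; meaningful only if \<open>u\<close> is a prefix of \<open>v\<close>.\<close>

definition left_quotient :: "'a list \<Rightarrow> 'a list \<Rightarrow> 'a list" where
  "left_quotient u v = drop (length u) v"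

subsection \<open>Quasiperiods\<close>

definition prefix_inf :: "'a list \<Rightarrow> 'a stream \<Rightarrow> bool" where
  "prefix_inf u t \<longleftrightarrow> (\<exists>s. t = u @- s)"

definition quasiperiod :: "'a list \<Rightarrow> 'a stream \<Rightarrow> bool" where
  "quasiperiod u t \<longleftrightarrow>
     (\<exists>p :: nat \<Rightarrow> 'a list. p 0 = [] \<and>
        (\<forall>n. length (p n) < length (p (Suc n)) \<and>
             length (p (Suc n)) \<le> length (p n @ u) \<and>
             prefix_inf (p n @ u) t))"

definition smallest_quasiperiod :: "'a list \<Rightarrow> 'a stream \<Rightarrow> bool" where
  "smallest_quasiperiod u t \<longleftrightarrow>
     quasiperiod u t \<and> (\<forall>u'. quasiperiod u' t \<longrightarrow> length u \<le> length u')"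

definition decomposition ::
  "'a stream \<Rightarrow> 'a list \<Rightarrow> 'a spinned list \<Rightarrow> 'a list \<Rightarrow> 'a stream \<Rightarrow> 'a spinned stream \<Rightarrow> bool"
where
  "decomposition t w ws v y ys \<longleftrightarrow>
     spinned_version ws w \<and> spinned_version_inf ys y \<and>
     directs (ws @- L_spinned v @- ys) t \<and>
     set v = sset (v @- y)"

text \<open>
  The length of \<open>wv\<close> is minimised over all decompositions of \<open>t\<close>, hence
  over all its directive words and not within a single one. For distinct letters
  \<open>a, b\<close> and writing capitals for spin R, \<open>abA(ba)\<^sup>\<omega>\<close> and
  \<open>ABa(ba)\<^sup>\<omega>\<close> direct the same word; the first gives its smallest
  quasiperiod \<open>Pal(ab) = aba\<close>, while the second alone only gives longer ones.
\<close>

definition minimal_decomposition ::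
  "'a stream \<Rightarrow> 'a list \<Rightarrow> 'a spinned list \<Rightarrow> 'a list \<Rightarrow> 'a stream \<Rightarrow> 'a spinned stream \<Rightarrow> bool"
where
  "minimal_decomposition t w ws v y ys \<longleftrightarrow>
     decomposition t w ws v y ys \<and>
     set (w @ v) = sset (w @- v @- y) \<and>
     (\<forall>w' ws' v' y' ys'. decomposition t w' ws' v' y' ys' \<and>
        set (w' @ v') = sset (w' @- v' @- y') \<longrightarrow> length (w @ v) \<le> length (w' @ v')) \<and>
     (\<forall>v'. suffix v' (w @ v) \<and> set v' = sset (v' @- y) \<longrightarrow> length v \<le> length v')"

end

theory Submission
  imports Defs "HOL-Library.Infinite_Set"
begin

text \<open>
  If \<open>t\<close> is desubstituted along a word \<open>u\<close>, then \<open>t\<close> arises from \<open>\<mu>\<^sub>u(t')\<close> by deleting a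
  prefix of \<open>Pal(u)\<close>, and the occurrences of \<open>Pal(u)\<close> in \<open>\<mu>\<^sub>u(t')\<close> are exactly the starting
  points of the blocks \<open>\<mu>\<^sub>u(b)\<close>, \<open>b\<close> a letter of \<open>t'\<close>. For \<open>u = wv\<close> with \<open>v\<close> the shortest suffix
  containing all letters of \<open>t'\<close>, the longest block has length \<open>|\<mu>\<^sub>w(Pal(v))| = |Pal(wv)| - |Pal(w)|\<close>.
  Every prefix \<open>q\<close> of \<open>t\<close> sits in some \<open>Pal(u)\<close> such that each occurrence of \<open>q\<close> extends to an
  occurrence of that \<open>Pal(u)\<close>; thus \<open>q\<close> is a quasiperiod iff it is at least as long as the longest
  block. The deleted prefix is then contained in \<open>Pal(w)\<close>, and spins on \<open>w\<close> alone can produce it,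
  because shifting factors of \<open>w\<close> attain all lengths up to \<open>|Pal(w)|\<close>. The length of the longest
  block does not decrease with \<open>u\<close>, whence the smallest quasiperiod.
\<close>

subsection \<open>Morphisms on finite words\<close>

text \<open>\<open>Pal\<close> recurses on the last letter of its argument and \<open>mu\<close> on
  the first, so the two do not share an induction; Justin's formula, taken as the definition of
  \<open>ipal\<close>, removes this obstacle. Its step, sending q to L_a(q)a, is the unit in which
  everything is desubstituted: it commutes with reversal, reflects the prefix order, and its values
  occur in an image under L_a exactly at starts of blocks. Hence palindromes, right special factors
  and occurrences all pass down one level by the same map. The second obstacle is that t may have
  directive words that differ even after the spins are erased, so quasiperiods obtained from
  different directive words must be compared. Along the same base word two desubstitutions of t
  differ only by finite prefixes; where base words diverge, t is forced to be periodic.\<close>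

abbreviation lext :: "'a \<Rightarrow> 'a list \<Rightarrow> 'a list" where
  "lext a \<equiv> extend (L_morph a)"

abbreviation rext :: "'a \<Rightarrow> 'a list \<Rightarrow> 'a list" where
  "rext a \<equiv> extend (R_morph a)"

abbreviation lmu :: "'a list \<Rightarrow> 'a list \<Rightarrow> 'a list" where
  "lmu w \<equiv> mu (L_spinned w)"

lemma extend_Nil [simp]: "extend f [] = []"
  and extend_Cons: "extend f (x # u) = f x @ extend f u"
  and extend_append [simp]: "extend f (u @ v) = extend f u @ extend f v"
  by (simp_all add: extend_def)

lemma mu_Nil_right [simp]: "mu ws [] = []"
  by (induction ws) auto

lemma mu_append_right [simp]: "mu ws (u @ v) = mu ws u @ mu ws v"
  by (induction ws) auto

lemma mu_append: "mu (ws @ xs) u = mu ws (mu xs u)"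
  by (induction ws) auto

lemma mu_letter_nonempty [simp]: "mu_letter x b \<noteq> []"
  by (cases x) (auto simp: L_morph_def R_morph_def)

lemma lext_Cons [simp]: "lext a (b # u) = (if b = a then a # lext a u else a # b # lext a u)"
  and rext_Cons [simp]: "rext a (b # u) = (if b = a then a # rext a u else b # a # rext a u)"
  by (auto simp: extend_Cons L_morph_def R_morph_def)

lemma lext_conj: "lext a u @ [a] = a # rext a u"
  by (induction u) (auto)

lemma rev_lext: "rev (lext a u) = rext a (rev u)"
  by (induction u) auto

text \<open>Reversal turns L_a into R_a, and the extra \<open>a\<close> turns it back by
  conjugation. So the map from u to L_a(u)a preserves palindromes.\<close>

lemma rev_lext_snoc: "rev (lext a u @ [a]) = lext a (rev u) @ [a]"
  using lext_conj[of a "rev u"] by (simp add: rev_lext)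

lemma length_lext_ge: "length u \<le> length (lext a u)"
  by (induction u) (auto)

lemma length_lext_gt: "b \<in> set u \<Longrightarrow> b \<noteq> a \<Longrightarrow> length u < length (lext a u)"
proof (induction u)
  case (Cons c u)
  then show ?case using length_lext_ge[of u a] by (auto)
qed simp

lemma extend_prefix: "prefix u v \<Longrightarrow> prefix (extend f u) (extend f v)"
  by (auto simp: prefix_def)

lemma mu_prefix: "prefix u v \<Longrightarrow> prefix (mu ws u) (mu ws v)"
  by (auto simp: prefix_def)

lemma lext_append_shift: "lext a u @ a # z = a # rext a u @ z"
  using lext_conj[of a u] by (metis append_Cons append_Nil append_assoc)

text \<open>The closing \<open>a\<close> shows where the last block ends. Without it the claim
  fails: L_a(a) = a is a prefix of L_a(b) = ab.\<close>

lemma lext_prefix_cancel: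
  "prefix (lext a u @ [a]) (lext a v @ [a]) \<Longrightarrow> prefix u v"
proof (induction u arbitrary: v)
  case (Cons b u)
  from Cons.prems obtain z where z: "lext a v @ [a] = lext a (b # u) @ a # z"
    by (auto simp: prefix_def)
  then obtain c v' where v: "v = c # v'" by (cases v) (auto split: if_splits)
  have "b = c \<and> lext a v' @ [a] = lext a u @ a # z"
    using z unfolding v by (auto simp: lext_append_shift split: if_splits)
  then show ?case using Cons.IH v by (auto simp: prefix_def)
qed simp

lemma lext_inj: "lext a u = lext a v \<Longrightarrow> u = v"
  by (metis lext_prefix_cancel prefix_order.antisym prefix_order.refl)

text \<open>Every \<open>a\<close> in L_a(v)a starts the block of a letter or is the final one, so a
  cut just before an \<open>a\<close> falls between two letters of v.\<close>

lemma lext_prefix_snoc: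
  assumes "prefix (p @ [a]) (lext a v @ [a])"
  shows "\<exists>u. prefix u v \<and> p = lext a u"
  using assms
proof (induction v arbitrary: p)
  case Nil
  then show ?case by (cases p) auto
next
  case (Cons b v)
  show ?case
  proof (cases p)
    case Nil
    then show ?thesis by (auto intro!: exI[of _ "[]"])
  next
    case p: (Cons c p')
    have ex: "\<exists>u. prefix u v \<and> q = lext a u"
      if "prefix (q @ [a]) (lext a v @ [a])" for q
      using Cons.IH that by blast
    show ?thesis
    proof (cases "b = a")
      case True
      then have "c = a" "prefix (p' @ [a]) (lext a v @ [a])" using Cons.prems p by auto
      then obtain u where "prefix u v" "p' = lext a u" using ex by blast
      then show ?thesis using True \<open>c = a\<close> p by (auto intro!: exI[of _ "a # u"])
    next
      case False
      with Cons.prems p have "c = a" "prefix (p' @ [a]) (b # lext a v @ [a])"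
        by (auto)
      with False obtain p'' where p'': "p' = b # p''" "prefix (p'' @ [a]) (lext a v @ [a])"
        by (cases p') auto
      then obtain u where "prefix u v" "p'' = lext a u" using ex by blast
      then show ?thesis using False \<open>c = a\<close> p p'' by (auto intro!: exI[of _ "b # u"])
    qed
  qed
qed

subsection \<open>Justin's formula for the iterated palindromic closure\<close>

text \<open>Justin's formula Pal(xw) = L_x(Pal(w))x as a recursion on the first letter; the
  agreement with \<open>Pal\<close> is \<open>Pal_eq_ipal\<close>.\<close>

primrec ipal :: "'a list \<Rightarrow> 'a list" where
  "ipal [] = []"
| "ipal (x # w) = lext x (ipal w) @ [x]"

lemma ipal_append: "ipal (w @ v) = lmu w (ipal v) @ ipal w"
  by (induction w) auto

lemma palindrome_ipal: "palindrome (ipal w)"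
proof (induction w)
  case (Cons a w)
  then show ?case unfolding palindrome_def ipal.simps rev_lext_snoc by simp
qed (simp add: palindrome_def)

lemma prefix_ipal_snoc: "prefix (ipal w @ [x]) (ipal (w @ [x]))"
proof (induction w)
  case (Cons a w)
  then obtain r where r: "ipal (w @ [x]) = ipal w @ x # r" by (auto simp: prefix_def)
  \<comment> \<open>L_a(xr)a begins with ax in both cases: by the definition of L_a if x \<noteq> a,
    by conjugation to R_a if x = a.\<close>
  obtain z where "lext a (x # r) @ [a] = a # x # z"
    by (cases "x = a") (simp_all add: lext_conj)
  then have "ipal ((a # w) @ [x]) = (ipal (a # w) @ [x]) @ z"
    using r by (simp del: lext_Cons)
  then show ?case by (rule prefixI)
qed simp

lemma prefix_ipal: "prefix (ipal w) (ipal (w @ v))"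
proof (induction v rule: rev_induct)
  case (snoc x v)
  have "prefix (ipal (w @ v)) (ipal ((w @ v) @ [x]))"
    by (rule append_prefixD[OF prefix_ipal_snoc])
  then have "prefix (ipal (w @ v)) (ipal (w @ v @ [x]))" by simp
  with snoc show ?case by (rule prefix_order.trans)
qed simp

lemma lmu_letter_notin: "b \<notin> set w \<Longrightarrow> lmu w [b] = ipal w @ [b]"
  by (induction w) (auto)

text \<open>The block of a letter of w fits into \<open>ipal w\<close>, so the copies of
  \<open>ipal w\<close> at two consecutive block starts touch or overlap; by
  \<open>lmu_letter_notin\<close>, a letter outside w leaves a gap of exactly one letter.\<close>

lemma lmu_letter_prefix: "b \<in> set w \<Longrightarrow> prefix (lmu w [b]) (ipal w)"
proof (induction w)
  case (Cons a w)
  show ?case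
  proof (cases "b \<in> set w")
    case True
    then have "prefix (lext a (lmu w [b])) (lext a (ipal w))" using Cons.IH extend_prefix by blast
    then show ?thesis by (simp add: prefix_prefix)
  next
    case False
    then show ?thesis using Cons.prems by (auto simp: lmu_letter_notin)
  qed
qed simp

text \<open>The source of Pal(v) in the theorem: if the first letter of v does not return in v, its
  block is all of Pal(v), the largest size that \<open>lmu_letter_prefix\<close> permits.\<close>

lemma lmu_first_letter: "d \<notin> set w \<Longrightarrow> lmu (d # w) [d] = ipal (d # w)"
  by (simp add: lmu_letter_notin)

lemma length_lmu_letter_le: "length (lmu w [b]) \<le> Suc (length (ipal w))"
  using lmu_letter_notin[of b w] lmu_letter_prefix[of b w, THEN prefix_length_le]
  by (cases "b \<in> set w") auto

text \<open>A nonempty palindromic prefix of L_a(Pal(w))a begins and therefore ends with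
  \<open>a\<close>, so it has the form L_a(u)a; reversal and injectivity make u a palindromic prefix
  of Pal(w).\<close>

lemma palindrome_prefix_ipal:
  "palindrome p \<Longrightarrow> prefix p (ipal w) \<Longrightarrow> \<exists>v. prefix v w \<and> p = ipal v"
proof (induction w arbitrary: p)
  case (Cons a w)
  show ?case
  proof (cases p)
    case Nil
    then show ?thesis by (auto intro!: exI[of _ "[]"])
  next
    case p: (Cons c p')
    have "prefix (c # p') (a # rext a (ipal w))"
      using Cons.prems(2) unfolding p ipal.simps lext_conj .
    then have "c = a" by simp
    then have "p = rev p' @ [a]" using Cons.prems(1) p by (simp add: palindrome_def)
    then obtain p1 where p1: "p = p1 @ [a]" by blast
    have "prefix (p1 @ [a]) (lext a (ipal w) @ [a])" using Cons.prems(2) unfolding p1 ipal.simps .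
    from lext_prefix_snoc[OF this] obtain u where u: "prefix u (ipal w)" "p1 = lext a u" by blast
    have "rev (lext a u @ [a]) = lext a u @ [a]"
      using Cons.prems(1) unfolding p1 u(2) palindrome_def .
    then have "lext a (rev u) = lext a u" unfolding rev_lext_snoc by simp
    then have "palindrome u" unfolding palindrome_def by (rule lext_inj)
    from Cons.IH[OF this u(1)] obtain v where "prefix v w" "u = ipal v" by blast
    then show ?thesis using p1 u(2) by (auto intro!: exI[of _ "a # v"])
  qed
qed simp

lemma strict_prefix_ipal_next:
  assumes "prefix (ipal v @ [x]) (ipal (v @ u))"
  shows "\<exists>u'. u = x # u'"
proof (cases u)
  case Nil
  then show ?thesis using assms prefix_length_le by fastforce
next
  case (Cons d u')
  have "prefix (ipal (v @ [d])) (ipal (v @ u))"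
    using prefix_ipal[of "v @ [d]" u'] Cons by simp
  with prefix_ipal_snoc[of v d] have "prefix (ipal v @ [d]) (ipal (v @ u))"
    by (rule prefix_order.trans)
  then have "prefix (ipal v @ [d]) (ipal v @ [x])"
    using assms by (rule prefix_length_prefix) simp
  then show ?thesis using Cons by simp
qed

text \<open>The block of x under w1 x w2 is Pal(w1 x w2) without its final Pal(w1). Hence appending
  x makes two copies of Pal(w1 x w2) overlap in Pal(w1).\<close>

lemma length_ipal_snoc_in:
  assumes "x \<notin> set w2"
  shows "length (ipal (w1 @ x # w2 @ [x])) + length (ipal w1) = 2 * length (ipal (w1 @ x # w2))"
proof -
  have "ipal (w1 @ x # w2 @ [x]) = lmu (w1 @ x # w2) [x] @ ipal (w1 @ x # w2)"
    using ipal_append[of "w1 @ x # w2" "[x]"] by simp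
  moreover have "lmu (w1 @ x # w2) [x] = lmu w1 (ipal (x # w2))"
    using lmu_first_letter[OF assms] by (simp add: mu_append del: ipal.simps)
  moreover have "ipal (w1 @ x # w2) = lmu w1 (ipal (x # w2)) @ ipal w1" by (rule ipal_append)
  ultimately show ?thesis by simp
qed

text \<open>The part of p beyond y mirrors the beginning of y; what remains of y is the centre of p,
  hence itself a palindrome.\<close>

lemma palindrome_above_decomp:
  assumes "palindrome p" "prefix y p" "length p \<le> 2 * length y"
  shows "p = y @ rev (take (length p - length y) y)"
    and "palindrome (drop (length p - length y) y)"
proof -
  define m where "m = length p - length y"
  obtain z where z: "p = y @ z" using assms(2) by (auto simp: prefix_def)
  have lz: "length z = m" "m \<le> length y" using z assms(3) by (auto simp: m_def)
  have r: "rev z @ rev y = y @ z" using assms(1) z by (simp add: palindrome_def)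
  then have "take m (rev z @ rev y) = take m (y @ z)" by simp
  then have "rev z = take m y" using lz by simp
  then have z': "z = rev (take m y)" by (simp add: rev_swap)
  then show "p = y @ rev (take (length p - length y) y)" using z m_def by simp
  have "take m y @ rev y = (take m y @ drop m y) @ rev (take m y)" using r z' by simp
  moreover have "rev y = rev (drop m y) @ rev (take m y)"
    by (simp flip: rev_append)
  ultimately have "take m y @ rev (drop m y) = take m y @ drop m y"
    by (metis append_assoc append_same_eq)
  then show "palindrome (drop (length p - length y) y)"
    by (simp only: palindrome_def same_append_eq m_def)
qed

text \<open>A shorter p would have a longer centre x r1 x, a palindromic suffix of Pal(w)x. By
  reversal r1 x is a prefix of Pal(w), so r1 = Pal(v) with vx a prefix of w. The longest such v ends
  before the last x of w, and that one yields precisely the length of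
  \<open>ipal (w @ [x])\<close>.\<close>

lemma ipal_snoc_shortest:
  assumes p: "palindrome p" and pre: "prefix (ipal w @ [x]) p"
  shows "length (ipal (w @ [x])) \<le> length p"
proof (rule ccontr)
  assume less: "\<not> ?thesis"
  define y where "y = ipal w @ [x]"
  have up: "length (ipal (w @ [x])) \<le> 2 * length (ipal w) + 1"
    using length_lmu_letter_le[of w x] unfolding ipal_append by simp
  then have plen: "length p \<le> 2 * length (ipal w)" using less by simp
  define r where "r = drop (length p - length y) y"
  have y: "prefix y p" "length p \<le> 2 * length y" using pre plen by (simp_all add: y_def)
  have rp: "palindrome r" unfolding r_def by (rule palindrome_above_decomp(2)[OF p y])
  have ly: "length y \<le> length p" using y(1) by (rule prefix_length_le)
  have rlen: "length r + length p = 2 * length y"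
    using ly y(2) unfolding r_def by simp
  \<comment> \<open>At least two letters, so the first and the last letter of the centre are
    different positions and r can be written x r1 x.\<close>
  have len2: "2 \<le> length r" using rlen plen by (simp add: y_def)
  define zs where "zs = take (length p - length y) y"
  have zs: "ipal w @ [x] = zs @ r"
    unfolding zs_def r_def append_take_drop_id by (rule y_def[symmetric])
  obtain r0 c where c: "r = r0 @ [c]" using len2 by (cases r rule: rev_cases) auto
  then have r0: "r = r0 @ [x]" "ipal w = zs @ r0" using zs by simp_all
  obtain e r1 where e: "r0 = e # r1" using len2 r0(1) by (cases r0) auto
  have "x # rev r1 @ [e] = e # r1 @ [x]"
    using rp unfolding palindrome_def r0(1) e by (simp only: rev.simps rev_append append_Cons append_Nil)
  then have "x = e" "rev r1 @ [e] = r1 @ [x]" by (simp_all only: list.inject)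
  then have r1: "r0 = x # r1" and r1p: "palindrome r1"
    unfolding e palindrome_def by (simp_all only: append1_eq_conv)
  have "rev (ipal w) = ipal w" using palindrome_ipal[of w] by (simp only: palindrome_def)
  then have "ipal w = (r1 @ [x]) @ rev zs"
    using r0(2) r1 r1p by (simp add: palindrome_def)
  then have pre1: "prefix (r1 @ [x]) (ipal w)" by (rule prefixI)
  from palindrome_prefix_ipal[OF r1p append_prefixD[OF pre1]]
  obtain v where v: "prefix v w" "r1 = ipal v" by blast
  obtain u where u: "w = v @ u" using v(1) by (auto simp: prefix_def)
  obtain u' where u': "u = x # u'"
    using strict_prefix_ipal_next[of v x u] pre1 unfolding u v(2) by blast
  then have "x \<in> set w" using u by simp
  then obtain w1 w2 where w12: "w = w1 @ x # w2" "x \<notin> set w2" by (metis split_list_last)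
  \<comment> \<open>v is followed by x in w, and no x comes after the one that follows w1.\<close>
  have "prefix v w1"
  proof -
    have "length v \<le> length w1"
    proof (rule ccontr)
      assume "\<not> ?thesis"
      then obtain k where k: "length v = length w1 + Suc k" using less_iff_Suc_add[of "length w1" "length v"] by auto
      have "w ! length v = x" "length v < length w" using u u' by auto
      then have "w2 ! k = x" "k < length w2" using w12(1) k by (auto simp: nth_append)
      then show False using w12(2) by auto
    qed
    moreover have "prefix w1 w" using w12(1) by simp
    ultimately show ?thesis using prefix_length_prefix[OF v(1)] by blast
  qed
  then obtain d where "w1 = v @ d" by (auto simp: prefix_def)
  then have "length (ipal v) \<le> length (ipal w1)"
    using prefix_length_le[OF prefix_ipal[of v d]] by simp
  moreover have "length (ipal (w @ [x])) + length (ipal w1) = 2 * length (ipal w)"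
    using length_ipal_snoc_in[OF w12(2), of w1] unfolding w12(1) append_assoc append_Cons .
  moreover have "length r = Suc (Suc (length (ipal v)))" unfolding r0(1) r1 v(2) by simp
  moreover have "length y = Suc (length (ipal w))" unfolding y_def by simp
  ultimately show False using rlen less by linarith
qed

text \<open>\<open>ARG_MIN\<close> fixes only the length of the closure. That length is at most
  twice the length of the given prefix, so it determines the palindrome.\<close>

lemma pal_closure_ipal: "pal_closure (ipal w @ [x]) = ipal (w @ [x])"
proof -
  let ?Q = "\<lambda>p. palindrome p \<and> prefix (ipal w @ [x]) p"
  let ?c = "pal_closure (ipal w @ [x])"
  have Q: "?Q (ipal (w @ [x]))" by (intro conjI palindrome_ipal prefix_ipal_snoc)
  have Qc: "?Q ?c" unfolding pal_closure_def by (rule arg_min_natI[where P = ?Q, OF Q])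
  have len: "length ?c = length (ipal (w @ [x]))"
    unfolding pal_closure_def
    by (rule arg_min_equality[where P = ?Q, OF Q], elim conjE, rule ipal_snoc_shortest)
  have le: "length (ipal (w @ [x])) \<le> 2 * length (ipal w @ [x])"
    using length_lmu_letter_le[of w x] unfolding ipal_append by simp
  have "?c = (ipal w @ [x]) @ rev (take (length ?c - length (ipal w @ [x])) (ipal w @ [x]))"
    by (rule palindrome_above_decomp(1)) (use Qc len le in simp_all)
  moreover have "ipal (w @ [x]) = (ipal w @ [x]) @
      rev (take (length (ipal (w @ [x])) - length (ipal w @ [x])) (ipal w @ [x]))"
    by (rule palindrome_above_decomp(1)) (use Q le in simp_all)
  ultimately show ?thesis using len by simp
qed

lemma Pal_eq_ipal: "Pal w = ipal w"
proof (induction w rule: rev_induct)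
  case (snoc x w)
  then show ?case using pal_closure_ipal[of w x] by (simp add: Pal_def)
qed (simp add: Pal_def)

subsection \<open>Shifting factors\<close>

lemma shifting_factor_Nil [simp]: "shifting_factor [] = []"
  by (simp add: shifting_factor_def)

lemma shifting_factor_snoc:
  "shifting_factor (ws @ [x]) =
     (if is_R x then lmu (map base ws) [base x] else []) @ shifting_factor ws"
proof -
  have "map (\<lambda>i. lmu (map base (take i (ws @ [x]))) [base ((ws @ [x]) ! i)])
      (filter (\<lambda>i. is_R ((ws @ [x]) ! i)) (rev [0..<length ws])) =
    map (\<lambda>i. lmu (map base (take i ws)) [base (ws ! i)])
      (filter (\<lambda>i. is_R (ws ! i)) (rev [0..<length ws]))"
    by (intro map_cong filter_cong) (auto simp: nth_append)
  then show ?thesis by (simp add: shifting_factor_def)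
qed

text \<open>The definition unfolds at the last letter; this form follows the recursion of
  \<open>mu\<close>.\<close>

lemma shifting_factor_Cons:
  "shifting_factor (x # ws) =
     lext (base x) (shifting_factor ws) @ (if is_R x then [base x] else [])"
proof (induction ws rule: rev_induct)
  case Nil
  then show ?case using shifting_factor_snoc[of "[]" x] by simp
next
  case (snoc y ws)
  then show ?case using shifting_factor_snoc[of "x # ws" y] by (simp add: shifting_factor_snoc)
qed

lemma shifting_factor_append_L [simp]: "shifting_factor (ws @ L_spinned v) = shifting_factor ws"
proof (induction v rule: rev_induct)
  case (snoc x v)
  then show ?case using shifting_factor_snoc[of "ws @ L_spinned v" "Spin_L x"] by simp
qed simp

lemma map_base_L_spinned [simp]: "map base (L_spinned v) = v"
  by (induction v) auto

lemma base_comp_Spin_L [simp]: "base \<circ> Spin_L = id"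
  by (simp add: fun_eq_iff)

text \<open>Spins only conjugate a morphism, by the shifting factor. In particular block lengths do
  not depend on them (\<open>length_mu\<close>).\<close>

lemma shifting_factor_conj:
  "shifting_factor ws @ mu ws u = lmu (map base ws) u @ shifting_factor ws"
proof (induction ws)
  case (Cons x ws)
  let ?a = "base x"
  have IH: "lext ?a (shifting_factor ws) @ lext ?a (mu ws u) =
      lext ?a (lmu (map base ws) u) @ lext ?a (shifting_factor ws)"
    using arg_cong[OF Cons.IH, of "lext ?a"] by simp
  show ?case
  proof (cases x)
    case (Spin_L a)
    then show ?thesis using IH by (simp add: shifting_factor_Cons)
  next
    case (Spin_R a)
    then have "shifting_factor (x # ws) @ mu (x # ws) u =
        lext a (shifting_factor ws) @ (a # rext a (mu ws u))"
      by (simp add: shifting_factor_Cons)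
    also have "\<dots> = (lext a (shifting_factor ws) @ lext a (mu ws u)) @ [a]"
      by (simp flip: lext_conj)
    also have "\<dots> = lmu (map base (x # ws)) u @ shifting_factor (x # ws)"
      using IH Spin_R by (simp add: shifting_factor_Cons)
    finally show ?thesis .
  qed
qed simp

lemma length_mu: "length (mu ws u) = length (lmu (map base ws) u)"
  using arg_cong[OF shifting_factor_conj[of ws u], of length] by simp

lemma shifting_factor_prefix: "prefix (shifting_factor ws) (ipal (map base ws))"
proof (induction ws)
  case (Cons x ws)
  then obtain r where r: "ipal (map base ws) = shifting_factor ws @ r" by (auto simp: prefix_def)
  have "prefix (if is_R x then [base x] else []) (lext (base x) r @ [base x])"
    by (simp add: lext_conj)
  then show ?case unfolding shifting_factor_Cons list.map ipal.simps r by simp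
qed simp

text \<open>
  The lengths of the images \<open>\<mu>\<^bsub>x\<^sub>1\<dots>x\<^sub>i\<^sub>-\<^sub>1\<^esub>(x\<^sub>i)\<close> form a complete sequence,
  since each of them exceeds the sum of the previous ones by at most one.
\<close>

lemma shifting_factor_of_length:
  "k \<le> length (ipal w) \<Longrightarrow> \<exists>ws. map base ws = w \<and> length (shifting_factor ws) = k"
proof (induction w arbitrary: k rule: rev_induct)
  case (snoc x w)
  show ?case
  proof (cases "k \<le> length (ipal w)")
    case True
    then obtain ws where "map base ws = w" "length (shifting_factor ws) = k"
      using snoc.IH by blast
    then show ?thesis by (intro exI[of _ "ws @ [Spin_L x]"]) (simp add: shifting_factor_snoc)
  next
    case False
    let ?h = "length (lmu w [x])"
    have h: "?h \<le> k" using False length_lmu_letter_le[of w x] by simp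
    have "k - ?h \<le> length (ipal w)" using snoc.prems by (simp add: ipal_append)
    then obtain ws where "map base ws = w" "length (shifting_factor ws) = k - ?h"
      using snoc.IH by blast
    then show ?thesis using h
      by (intro exI[of _ "ws @ [Spin_R x]"]) (simp add: shifting_factor_snoc)
  qed
qed simp

subsection \<open>Morphisms on infinite words\<close>

abbreviation linf :: "'a \<Rightarrow> 'a stream \<Rightarrow> 'a stream" where
  "linf a \<equiv> extend_inf (L_morph a)"

abbreviation rinf :: "'a \<Rightarrow> 'a stream \<Rightarrow> 'a stream" where
  "rinf a \<equiv> extend_inf (R_morph a)"

primrec mu_inf :: "'a spinned list \<Rightarrow> 'a stream \<Rightarrow> 'a stream" where
  "mu_inf [] t = t"
| "mu_inf (x # ws) t = extend_inf (mu_letter x) (mu_inf ws t)"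

abbreviation lmu_inf :: "'a list \<Rightarrow> 'a stream \<Rightarrow> 'a stream" where
  "lmu_inf w \<equiv> mu_inf (L_spinned w)"

lemma stream_eqI_stake:
  assumes "\<And>n. stake n s = stake n s'" shows "s = s'"
proof -
  have "s !! n = s' !! n" for n
    using arg_cong[OF assms[of "Suc n"], of "\<lambda>u. u ! n"] by (simp only: stake_nth lessI)
  then have "smap id s = s'" unfolding smap_alt by simp
  then show ?thesis by (simp add: stream.map_id)
qed

lemma shift_eq_prefix:
  assumes "u @- s = v @- s'" "length u \<le> length v"
  shows "prefix u v"
proof -
  have "stake (length u) (u @- s) = stake (length u) (v @- s')" using assms(1) by simp
  then have "take (length u) v = u" using assms(2) by (simp add: stake_shift)
  then show ?thesis using take_is_prefix[of "length u" v] by simp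
qed

lemma extend_inf_shift:
  "(\<And>b. f b \<noteq> []) \<Longrightarrow> extend_inf f (u @- t) = extend f u @- extend_inf f t"
  by (induction u) (auto simp: extend_inf_def extend_Cons)

lemma mu_letter_inf_shift:
  "extend_inf (mu_letter x) (u @- t) = extend (mu_letter x) u @- extend_inf (mu_letter x) t"
  by (rule extend_inf_shift) simp

lemma linf_shift: "linf a (u @- t) = lext a u @- linf a t"
  and rinf_shift: "rinf a (u @- t) = rext a u @- rinf a t"
  using mu_letter_inf_shift[of "Spin_L a"] mu_letter_inf_shift[of "Spin_R a"] by simp_all

lemma mu_inf_shift: "mu_inf ws (u @- t) = mu ws u @- mu_inf ws t"
  by (induction ws) (auto simp: mu_letter_inf_shift)

lemma mu_inf_append: "mu_inf (ws @ xs) t = mu_inf ws (mu_inf xs t)"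
  by (induction ws) auto

lemma linf_Stream [simp]:
  "linf a (b ## t) = (if b = a then a ## linf a t else a ## b ## linf a t)"
  using linf_shift[of a "[b]" t] by simp

lemma linf_unfold: "linf a t = a ## stl (linf a t)"
  by (cases t) simp

lemma shd_linf [simp]: "shd (linf a t) = a"
  by (cases t) simp

text \<open>The trailing \<open>a\<close> of \<open>lext_conj\<close> moves off to infinity: on
  infinite words spin R is spin L followed by deleting the first letter.\<close>

lemma linf_eq_rinf: "linf a t = a ## rinf a t"
proof (rule stream_eqI_stake)
  fix n
  let ?u = "stake n t" and ?s = "sdrop n t"
  have "linf a t = lext a ?u @- linf a ?s" using linf_shift[of a ?u ?s] by (simp add: stake_sdrop)
  also have "\<dots> = (lext a ?u @ [a]) @- stl (linf a ?s)"
    using linf_unfold[of a ?s] by simp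
  finally have 1: "linf a t = (a # rext a ?u) @- stl (linf a ?s)" by (simp only: lext_conj)
  have 2: "a ## rinf a t = (a # rext a ?u) @- rinf a ?s"
    using rinf_shift[of a ?u ?s] by (simp add: stake_sdrop)
  have "n \<le> length (a # rext a ?u)"
    using length_lext_ge[of ?u a] arg_cong[OF lext_conj[of a ?u], of length] by simp
  then show "stake n (linf a t) = stake n (a ## rinf a t)"
    unfolding 1 2 by (simp only: stake_shift) simp
qed

lemma shifting_factor_mu_inf: "shifting_factor ws @- mu_inf ws t = lmu_inf (map base ws) t"
proof (induction ws)
  case (Cons x ws)
  have IH: "lext (base x) (shifting_factor ws) @- linf (base x) (mu_inf ws t) =
      linf (base x) (lmu_inf (map base ws) t)"
    using arg_cong[OF Cons.IH, of "linf (base x)"] by (simp add: linf_shift)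
  then show ?case
    by (cases x) (simp_all add: shifting_factor_Cons linf_eq_rinf)
qed simp

text \<open>On infinite words the whole effect of the spins is one number, the count of deleted
  letters; the later arguments work with L-images and such an offset.\<close>

lemma mu_inf_eq_sdrop: "mu_inf ws t = sdrop (length (shifting_factor ws)) (lmu_inf (map base ws) t)"
  unfolding shifting_factor_mu_inf[symmetric] by (simp add: sdrop_shift)

lemma sdrop_mu_inf: "sdrop (length (mu ws (stake i t))) (mu_inf ws t) = mu_inf ws (sdrop i t)"
proof -
  have "mu_inf ws t = mu ws (stake i t) @- mu_inf ws (sdrop i t)"
    by (simp add: stake_sdrop flip: mu_inf_shift)
  then show ?thesis by (simp add: sdrop_shift)
qed

lemma stake_mu_inf: "stake (length (mu ws (stake i t))) (mu_inf ws t) = mu ws (stake i t)"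
proof -
  have "mu_inf ws t = mu ws (stake i t) @- mu_inf ws (sdrop i t)"
    by (simp add: stake_sdrop flip: mu_inf_shift)
  then show ?thesis by (simp add: stake_shift)
qed

lemma sdrop_linf: "sdrop (length (lext a (stake i t))) (linf a t) = linf a (sdrop i t)"
  using sdrop_mu_inf[of "[Spin_L a]"] by simp

subsection \<open>Occurrences and recurrence\<close>

lemma occurs_at_iff: "occurs_at u t i \<longleftrightarrow> (\<exists>s. sdrop i t = u @- s)"
proof
  assume "occurs_at u t i"
  then have "sdrop i t = u @- sdrop (length u) (sdrop i t)"
    unfolding occurs_at_def by (metis stake_sdrop)
  then show "\<exists>s. sdrop i t = u @- s" by blast
qed (auto simp: occurs_at_def stake_shift)

lemma occurs_at_sdrop: "occurs_at u (sdrop k t) i \<longleftrightarrow> occurs_at u t (k + i)"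
  by (simp add: occurs_at_def)

lemma occurs_at_append:
  "occurs_at (u @ v) t i \<longleftrightarrow> occurs_at u t i \<and> occurs_at v t (i + length u)"
proof
  assume "occurs_at (u @ v) t i"
  then obtain s where s: "sdrop i t = u @- v @- s" by (auto simp: occurs_at_iff)
  moreover have "sdrop (i + length u) t = sdrop (length u) (sdrop i t)" by simp
  ultimately show "occurs_at u t i \<and> occurs_at v t (i + length u)"
    by (auto simp: occurs_at_iff sdrop_shift simp del: sdrop_add)
next
  assume a: "occurs_at u t i \<and> occurs_at v t (i + length u)"
  then obtain s s' where s: "sdrop i t = u @- s" "sdrop (i + length u) t = v @- s'"
    by (auto simp: occurs_at_iff)
  have "s = sdrop (length u) (sdrop i t)" unfolding s(1) by (simp add: sdrop_shift)
  also have "\<dots> = v @- s'" using s(2) by simp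
  finally show "occurs_at (u @ v) t i" using s(1) by (auto simp: occurs_at_iff)
qed

lemma occurs_at_prefix: "prefix v u \<Longrightarrow> occurs_at u t i \<Longrightarrow> occurs_at v t i"
  by (auto simp: prefix_def occurs_at_append)

lemma occurs_at_singleton: "occurs_at [b] t i \<longleftrightarrow> t !! i = b"
  by (simp add: occurs_at_def sdrop_snth)

lemma recurrentD:
  assumes "recurrent t" "occurs_at u t i"
  obtains j where "N \<le> j" "occurs_at u t j"
  using assms unfolding recurrent_def factor_def infinite_nat_iff_unbounded_le by blast

text \<open>Prefixes suffice, since every factor ends some prefix.\<close>

lemma recurrentI:
  assumes "\<And>m N. \<exists>j\<ge>N. occurs_at (stake m t) t j"
  shows "recurrent t"
  unfolding recurrent_def
proof (intro allI impI)
  fix u assume "factor u t"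
  then obtain i where i: "occurs_at u t i" by (auto simp: factor_def)
  show "infinite {j. occurs_at u t j}"
    unfolding infinite_nat_iff_unbounded_le
  proof
    fix N
    obtain j where j: "N \<le> j" "occurs_at (stake (i + length u) t) t j" using assms by blast
    have "stake (i + length u) t = stake i t @ u"
      using i by (simp add: occurs_at_def flip: stake_add)
    then have "occurs_at u t (j + i)" using j(2) by (simp add: occurs_at_append)
    then show "\<exists>n\<ge>N. n \<in> {j. occurs_at u t j}" using j(1) by (intro exI[of _ "j + i"]) simp
  qed
qed

lemma factor_sdrop: "factor u (sdrop k t) \<Longrightarrow> factor u t"
  by (auto simp: factor_def occurs_at_sdrop)

lemma factor_sdrop_iff:
  assumes "recurrent t" shows "factor u (sdrop k t) \<longleftrightarrow> factor u t"
proof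
  assume "factor u t"
  then obtain i where "occurs_at u t i" by (auto simp: factor_def)
  then obtain j where "k \<le> j" "occurs_at u t j" by (rule recurrentD[OF assms])
  then have "occurs_at u (sdrop k t) (j - k)" by (simp add: occurs_at_sdrop)
  then show "factor u (sdrop k t)" by (auto simp: factor_def)
qed (rule factor_sdrop)

lemma factor_singleton: "factor [b] t \<longleftrightarrow> b \<in> sset t"
  by (auto simp: factor_def occurs_at_singleton sset_range)

lemma sset_sdrop_recurrent: "recurrent t \<Longrightarrow> sset (sdrop k t) = sset t"
  using factor_sdrop_iff[of t "[_]" k] by (auto simp: factor_singleton)

lemma occurs_at_mu_inf:
  assumes "occurs_at u t i"
  shows "occurs_at (mu ws u) (mu_inf ws t) (length (mu ws (stake i t)))"
  using assms unfolding occurs_at_iff sdrop_mu_inf by (auto simp: mu_inf_shift)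

lemma length_mu_ge: "length u \<le> length (mu ws u)"
proof -
  have "length u \<le> length (lmu w u)" for w
  proof (induction w)
    case (Cons a w)
    then show ?case using length_lext_ge[of "lmu w u" a] by simp
  qed simp
  then show ?thesis by (simp only: length_mu[of ws])
qed

lemma stake_mu_inf_le:
  "stake m (mu_inf ws t) = take m (mu ws (stake m t))"
proof -
  have "mu_inf ws t = mu ws (stake m t) @- mu_inf ws (sdrop m t)"
    by (simp add: stake_sdrop flip: mu_inf_shift)
  moreover have "m \<le> length (mu ws (stake m t))" using length_mu_ge[of "stake m t" ws] by simp
  ultimately show ?thesis by (simp add: stake_shift)
qed

lemma recurrent_mu_inf:
  assumes "recurrent t" shows "recurrent (mu_inf ws t)"
proof (rule recurrentI)
  fix m N
  have "occurs_at (stake m t) t 0" by (simp add: occurs_at_def)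
  then obtain j where j: "N \<le> j" "occurs_at (stake m t) t j" by (rule recurrentD[OF assms])
  let ?k = "length (mu ws (stake j t))"
  have "occurs_at (mu ws (stake m t)) (mu_inf ws t) ?k" by (rule occurs_at_mu_inf[OF j(2)])
  then have "occurs_at (stake m (mu_inf ws t)) (mu_inf ws t) ?k"
    unfolding stake_mu_inf_le by (rule occurs_at_prefix[OF take_is_prefix])
  moreover have "N \<le> ?k" using j(1) length_mu_ge[of "stake j t" ws] by simp
  ultimately show "\<exists>j\<ge>N. occurs_at (stake m (mu_inf ws t)) (mu_inf ws t) j" by blast
qed

subsection \<open>Desubstitution of occurrences\<close>

lemma linf_prefix_cancel:
  assumes "linf a t = (lext a q @ [a]) @- s"
  shows "\<exists>s'. t = q @- s'"
proof -
  let ?n = "length (lext a q)"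
  let ?u = "stake ?n t" and ?r = "sdrop ?n t"
  have "linf a t = lext a ?u @- linf a ?r" by (simp add: stake_sdrop flip: linf_shift)
  also have "\<dots> = (lext a ?u @ [a]) @- stl (linf a ?r)" using linf_unfold[of a ?r] by simp
  finally have "(lext a q @ [a]) @- s = (lext a ?u @ [a]) @- stl (linf a ?r)" using assms by simp
  moreover have "?n \<le> length (lext a ?u)" using length_lext_ge[of ?u a] by simp
  ultimately have "prefix (lext a q @ [a]) (lext a ?u @ [a])" by (intro shift_eq_prefix) simp_all
  then have "prefix q ?u" by (rule lext_prefix_cancel)
  then obtain z where "?u = q @ z" by (auto simp: prefix_def)
  then have "t = q @- z @- ?r" using stake_sdrop[of ?n t] by (simp flip: shift_append)
  then show ?thesis by blast
qed

lemma linf_inj: assumes "linf a t = linf a t'" shows "t = t'"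
proof (rule stream_eqI_stake)
  fix n
  let ?u = "stake n t" and ?r = "sdrop n t"
  have "linf a t = lext a ?u @- linf a ?r" by (simp add: stake_sdrop flip: linf_shift)
  also have "\<dots> = (lext a ?u @ [a]) @- stl (linf a ?r)" using linf_unfold[of a ?r] by simp
  finally have "linf a t' = (lext a ?u @ [a]) @- stl (linf a ?r)" using assms by simp
  from linf_prefix_cancel[OF this] obtain s' where "t' = ?u @- s'" by blast
  then show "stake n t = stake n t'" by (simp add: stake_shift)
qed

lemma lmu_inf_inj: "lmu_inf w t = lmu_inf w t' \<Longrightarrow> t = t'"
proof (induction w)
  case (Cons a w)
  then show ?case using linf_inj[of a "lmu_inf w t" "lmu_inf w t'"] by simp
qed simp

lemma linf_position:
  "\<exists>i. j = length (lext a (stake i t)) \<or>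
       t !! i \<noteq> a \<and> j = Suc (length (lext a (stake i t)))"
proof (induction j)
  case 0
  show ?case by (rule exI[of _ 0]) simp
next
  case (Suc j)
  then obtain i where i: "j = length (lext a (stake i t)) \<or>
       t !! i \<noteq> a \<and> j = Suc (length (lext a (stake i t)))" by blast
  have len: "length (lext a (stake (Suc i) t)) =
      length (lext a (stake i t)) + (if t !! i = a then 1 else 2)"
    by (simp add: stake_Suc del: stake.simps)
  show ?case
  proof (cases "t !! i \<noteq> a \<and> j = length (lext a (stake i t))")
    case True
    then show ?thesis by (intro exI[of _ i]) simp
  next
    case False
    then show ?thesis using i len by (intro exI[of _ "Suc i"]) (auto simp del: stake.simps)
  qed
qed

lemma linf_snth_Suc:
  assumes "t !! i \<noteq> a"
  shows "linf a t !! Suc (length (lext a (stake i t))) = t !! i"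
proof -
  have "linf a t !! Suc (length (lext a (stake i t))) =
      sdrop (length (lext a (stake i t))) (linf a t) !! 1"
    by (simp add: sdrop_snth)
  also have "\<dots> = linf a (sdrop i t) !! 1" by (simp only: sdrop_linf)
  also have "sdrop i t = (t !! i) ## sdrop (Suc i) t"
    using stream.collapse[of "sdrop i t"] unfolding sdrop_simps by (rule sym)
  finally show ?thesis using assms by simp
qed

lemma linf_snth_boundary: "linf a t !! length (lext a (stake i t)) = a"
proof -
  have "linf a t !! length (lext a (stake i t)) =
      shd (sdrop (length (lext a (stake i t))) (linf a t))" by (simp add: sdrop_snth)
  then show ?thesis by (simp add: sdrop_linf)
qed

lemma linf_snth_eqD:
  assumes "linf a t !! j = a"
  obtains i where "j = length (lext a (stake i t))"
proof -
  from linf_position[of j a t] obtain i where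
    "j = length (lext a (stake i t)) \<or> t !! i \<noteq> a \<and> j = Suc (length (lext a (stake i t)))" by blast
  then show ?thesis using that linf_snth_Suc[of t i a] assms by auto
qed

lemma linf_snth_neqD:
  assumes "linf a t !! j \<noteq> a"
  obtains i where "j = Suc (length (lext a (stake i t)))" "t !! i = linf a t !! j"
proof -
  from linf_position[of j a t] obtain i where
    "j = length (lext a (stake i t)) \<or> t !! i \<noteq> a \<and> j = Suc (length (lext a (stake i t)))" by blast
  then show ?thesis using that linf_snth_Suc[of t i a] linf_snth_boundary[of a t i] assms by auto
qed

text \<open>The leading \<open>a\<close> forces an occurrence to start at a block, the trailing
  \<open>a\<close> forces the block of the last letter of q to be complete.\<close>

lemma linf_occurs_at:
  "occurs_at (lext a q @ [a]) (linf a t) j \<longleftrightarrow>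
     (\<exists>i. j = length (lext a (stake i t)) \<and> occurs_at q t i)"
proof
  assume occ: "occurs_at (lext a q @ [a]) (linf a t) j"
  then have "occurs_at [a] (linf a t) j"
    unfolding lext_conj using occurs_at_append[of "[a]" "rext a q"] by simp
  then obtain i where i: "j = length (lext a (stake i t))"
    unfolding occurs_at_singleton by (rule linf_snth_eqD)
  obtain s where "linf a (sdrop i t) = (lext a q @ [a]) @- s"
    using occ unfolding occurs_at_iff i sdrop_linf by blast
  from linf_prefix_cancel[OF this] show "\<exists>i. j = length (lext a (stake i t)) \<and> occurs_at q t i"
    using i unfolding occurs_at_iff by blast
next
  assume "\<exists>i. j = length (lext a (stake i t)) \<and> occurs_at q t i"
  then obtain i s where i: "j = length (lext a (stake i t))" "sdrop i t = q @- s"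
    by (auto simp: occurs_at_iff)
  have "sdrop j (linf a t) = (lext a q @ [a]) @- stl (linf a s)"
    unfolding i(1) sdrop_linf i(2) linf_shift using linf_unfold[of a s] by simp
  then show "occurs_at (lext a q @ [a]) (linf a t) j" unfolding occurs_at_iff by blast
qed

text \<open>The empty word occurs at every position of t, and each step of \<open>ipal\<close> is
  the map treated in \<open>linf_occurs_at\<close>.\<close>

lemma ipal_occurs_at:
  "occurs_at (ipal w) (lmu_inf w t) j \<longleftrightarrow> (\<exists>i. j = length (lmu w (stake i t)))"
proof (induction w arbitrary: j)
  case Nil
  show ?case by (simp add: occurs_at_def)
next
  case (Cons a w)
  have "occurs_at (ipal (a # w)) (lmu_inf (a # w) t) j \<longleftrightarrow>
      (\<exists>i. j = length (lext a (stake i (lmu_inf w t))) \<and> occurs_at (ipal w) (lmu_inf w t) i)"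
    using linf_occurs_at[of a "ipal w" "lmu_inf w t" j] by simp
  also have "\<dots> \<longleftrightarrow>
      (\<exists>i. j = length (lext a (stake (length (lmu w (stake i t))) (lmu_inf w t))))"
    unfolding Cons.IH by blast
  also have "\<dots> \<longleftrightarrow> (\<exists>i. j = length (lmu (a # w) (stake i t)))"
    by (simp add: stake_mu_inf)
  finally show ?case .
qed

subsection \<open>Desubstitution of episturmian words\<close>

lemma factor_appendD1: "factor (u @ v) t \<Longrightarrow> factor u t"
  and factor_appendD2: "factor (u @ v) t \<Longrightarrow> factor v t"
  by (auto simp: factor_def occurs_at_append)

lemma factor_prefix: "prefix v u \<Longrightarrow> factor u t \<Longrightarrow> factor v t"
  by (auto simp: prefix_def intro: factor_appendD1)

text \<open>If a prefix had only finitely many occurrences, the prefix P ending with its last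
  occurrence would occur only at 0. Then \<open>rev P\<close> occurs only once, because a factor
  spanned by two occurrences of it would reverse to one containing P twice.\<close>

lemma reversal_closed_recurrent:
  assumes rev_closed: "\<And>u. factor u t \<Longrightarrow> factor (rev u) t"
  shows "recurrent t"
proof (rule recurrentI, rule ccontr)
  fix m N
  assume none: "\<not> (\<exists>j\<ge>N. occurs_at (stake m t) t j)"
  define J where "J = {j. occurs_at (stake m t) t j}"
  have "J \<subseteq> {..<N}" unfolding J_def using none not_less by blast
  then have fin: "finite J" by (rule finite_subset) simp
  have "0 \<in> J" by (simp add: J_def occurs_at_def)
  then have "Max J \<in> J" using fin by (intro Max_in) auto
  define P where "P = stake (Max J + m) t"
  have "P = stake (Max J) t @ stake m (sdrop (Max J) t)" by (simp add: P_def)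
  also have "stake m (sdrop (Max J) t) = stake m t"
    using \<open>Max J \<in> J\<close> by (simp add: J_def occurs_at_def)
  finally have P: "P = stake (Max J) t @ stake m t" .
  have P_only: "j = 0" if "occurs_at P t j" for j
  proof -
    have "j + Max J \<in> J" using that unfolding P occurs_at_append J_def by simp
    then have "j + Max J \<le> Max J" using fin by (intro Max_ge)
    then show ?thesis by simp
  qed
  have unique: False if "occurs_at (rev P) t i" "occurs_at (rev P) t (i + d)" "0 < d" for i d
  proof -
    define z where "z = stake (d + length P) (sdrop i t)"
    have z1: "z = rev P @ drop (length P) z"
    proof -
      have "take (length P) z = rev P" using that(1) by (simp add: z_def take_stake occurs_at_def)
      then show ?thesis using append_take_drop_id[of "length P" z] by simp
    qed
    have z2: "z = take d z @ rev P"
    proof -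
      have "drop d z = rev P" using that(2) by (simp add: z_def drop_stake occurs_at_def)
      then show ?thesis using append_take_drop_id[of d z] by simp
    qed
    have lz: "length z = d + length P" by (simp add: z_def)
    have "factor z t" by (auto simp: factor_def occurs_at_def z_def intro!: exI[of _ i])
    then obtain k where k: "occurs_at (rev z) t k" using rev_closed by (auto simp: factor_def)
    have "rev z = P @ rev (take d z)" using arg_cong[OF z2, of rev] by simp
    have "rev z = rev (drop (length P) z) @ P" using arg_cong[OF z1, of rev] by simp
    then have "occurs_at P t (k + length (drop (length P) z))" using k by (simp add: occurs_at_append)
    then have "k + length (drop (length P) z) = 0" by (rule P_only)
    then show False using lz that(3) by simp
  qed
  have "occurs_at P t 0" by (simp add: occurs_at_def P_def)
  then have "factor (rev P) t" using rev_closed by (auto simp: factor_def)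
  then obtain i where i: "occurs_at (rev P) t i" by (auto simp: factor_def)
  \<comment> \<open>P prolonged by more letters than precede the occurrence i; its reversal puts
    \<open>rev P\<close> at a position beyond i.\<close>
  define Q where "Q = stake (length P + Suc i) t"
  have Q: "Q = P @ stake (Suc i) (sdrop (length P) t)" unfolding Q_def P_def by (simp del: stake.simps)
  have "factor Q t" unfolding factor_def by (rule exI[of _ 0]) (simp add: occurs_at_def Q_def)
  then have "factor (rev Q) t" by (rule rev_closed)
  then obtain k where "occurs_at (rev Q) t k" by (auto simp: factor_def)
  then have "occurs_at (rev P) t (k + Suc i)"
    unfolding Q rev_append occurs_at_append by (simp del: stake.simps)
  then show False using unique[of i "Suc k"] i by (simp add: add.commute)
qed

lemma episturmian_recurrent: "episturmian t \<Longrightarrow> recurrent t"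
  by (rule reversal_closed_recurrent) (simp add: episturmian_def)

definition separating :: "'a \<Rightarrow> 'a stream \<Rightarrow> bool" where
  "separating a t \<longleftrightarrow> (\<forall>i. t !! i = a \<or> t !! Suc i = a)"

lemma occurs_at_pair: "occurs_at [b, c] t i \<longleftrightarrow> t !! i = b \<and> t !! Suc i = c"
  using occurs_at_append[of "[b]" "[c]" t i] by (simp add: occurs_at_singleton)

text \<open>A right special letter a is the only one of its length. Were two neighbours b, c both
  different from a, then, bc and cb being factors, b could be followed only by c and c only by b; t
  would alternate forever, although a recurs. Without any right special letter t alternates from the
  start.\<close>

lemma episturmian_separating:
  assumes epi: "episturmian t"
  shows "\<exists>a. separating a t"
proof -
  have pair: "factor [t !! i, t !! Suc i] t" for i
    unfolding factor_def by (rule exI[of _ i]) (simp add: occurs_at_pair)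
  have swap: "factor [c, b] t" if "factor [b, c] t" for b c
    using epi that by (auto simp: episturmian_def dest: spec[of _ "[b, c]"])
  have alternate: "t !! (i + n) = b \<and> t !! Suc (i + n) = c \<or> t !! (i + n) = c \<and> t !! Suc (i + n) = b"
    if ns: "\<not> right_special [b] t" "\<not> right_special [c] t" and bc: "t !! i = b" "t !! Suc i = c"
    for i n b c
  proof (induction n)
    case (Suc n)
    have f1: "factor [b, c] t" using pair[of i] bc by simp
    then have f2: "factor [c, b] t" by (rule swap)
    have f3: "factor [t !! Suc (i + n), t !! Suc (Suc (i + n))] t" by (rule pair)
    have "e = c" if "factor [b, e] t" for e
      using ns(1) that f1 unfolding right_special_def by (metis append_Cons append_Nil)
    moreover have "e = b" if "factor [c, e] t" for e
      using ns(2) that f2 unfolding right_special_def by (metis append_Cons append_Nil)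
    ultimately show ?case using Suc f3 by auto
  qed (use bc in simp)
  show ?thesis
  proof (cases "\<exists>a. right_special [a] t")
    case True
    then obtain a where a: "right_special [a] t" by blast
    then have "factor [a] t" unfolding right_special_def by (auto dest: factor_appendD1[of "[a]" "[_]", simplified])
    then obtain k where k: "occurs_at [a] t k" by (auto simp: factor_def)
    have ns: "\<not> right_special [b] t" if "b \<noteq> a" for b
    proof
      assume "right_special [b] t"
      then have "[b] = [a]" using epi a unfolding episturmian_def Uniq_def
        by (metis length_Cons)
      then show False using that by simp
    qed
    have "separating a t"
      unfolding separating_def
    proof (rule allI, rule ccontr)
      fix i assume no: "\<not> (t !! i = a \<or> t !! Suc i = a)"
      obtain j where j: "i \<le> j" "occurs_at [a] t j"
        using recurrentD[OF episturmian_recurrent[OF epi] k] by blast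
      have "t !! (i + (j - i)) \<noteq> a"
        using alternate[of "t !! i" "t !! Suc i" i "j - i"] ns no by auto
      then show False using j by (simp add: occurs_at_singleton)
    qed
    then show ?thesis by blast
  next
    case False
    then have "separating (t !! 0) t"
      using alternate[of "t !! 0" "t !! Suc 0" 0] unfolding separating_def by auto
    then show ?thesis by blast
  qed
qed

text \<open>Inverse of L_a on words that start with a separating \<open>a\<close>. The second letter
  is the decoded one in both cases: if it is \<open>a\<close>, the first block was \<open>a\<close>
  alone and the second letter opens the next block.\<close>

primcorec lcut :: "'a \<Rightarrow> 'a stream \<Rightarrow> 'a stream" where
  "lcut a s = shd (stl s) ## lcut a (if shd (stl s) = a then stl s else stl (stl s))"

lemma separating_stl: "separating a s \<Longrightarrow> separating a (stl s)"
  unfolding separating_def by (metis snth.simps(2))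

lemma separating_Stream: assumes "separating a t" shows "separating a (a ## t)"
  unfolding separating_def
proof
  fix i
  show "(a ## t) !! i = a \<or> (a ## t) !! Suc i = a"
    using assms by (cases i) (simp_all add: separating_def)
qed

lemma linf_lcut:
  assumes "separating a s" "shd s = a"
  shows "linf a (lcut a s) = s"
proof (rule stream_eqI_stake)
  fix n
  show "stake n (linf a (lcut a s)) = stake n s"
    using assms
  proof (induction n arbitrary: s rule: less_induct)
    case (less n)
    show ?case
    proof (cases n)
      case (Suc m)
      show ?thesis
      proof (cases "shd (stl s) = a")
        case True
        then have "linf a (lcut a s) = a ## linf a (lcut a (stl s))" by (subst lcut.code) simp
        then show ?thesis
          using less.IH[of m "stl s"] Suc less.prems True by (simp add: separating_stl)
      next
        case False
        then have eq: "linf a (lcut a s) = a ## shd (stl s) ## linf a (lcut a (stl (stl s)))"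
          by (subst lcut.code) simp
        have "s !! Suc (Suc 0) = a"
          using False less.prems(1) unfolding separating_def by (metis snth.simps)
        then have "shd (stl (stl s)) = a" by simp
        then show ?thesis
          using less.IH[of "m - 1" "stl (stl s)"] less.prems Suc eq
          by (cases m) (simp_all add: separating_stl)
      qed
    qed simp
  qed
qed

lemma right_special_appendD: "right_special (u @ v) t \<Longrightarrow> right_special v t"
  unfolding right_special_def using factor_appendD2 by (metis append_assoc)

text \<open>If t does not begin with the separating letter, one is prepended before decoding, and e
  = 1 records this. Factors u of t1 correspond to factors L_a(u)a of t, so closure under reversal
  and right special factors carry over.\<close>

lemma episturmian_desubstitution:
  assumes epi: "episturmian t"
  obtains a e t1 where "e \<le> 1" "t = sdrop e (linf a t1)" "episturmian t1"
proof -
  obtain a where sep: "separating a t" using episturmian_separating[OF epi] by blast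
  define e :: nat where "e = (if shd t = a then 0 else 1)"
  define s where "s = (if shd t = a then t else a ## t)"
  define t1 where "t1 = lcut a s"
  have "separating a s"
    unfolding s_def using sep separating_Stream[OF sep] by simp
  moreover have "shd s = a" by (simp add: s_def)
  ultimately have s: "linf a t1 = s" unfolding t1_def by (rule linf_lcut)
  have ts: "t = sdrop e s" by (simp add: s_def e_def)
  have rec: "recurrent t" using epi by (rule episturmian_recurrent)
  have fac1: "factor u t1" if "factor (lext a u @ [a]) t" for u
  proof -
    have "factor (lext a u @ [a]) (linf a t1)" using that unfolding ts s by (rule factor_sdrop)
    then show ?thesis unfolding factor_def linf_occurs_at by blast
  qed
  have fac2: "factor (lext a u @ [a]) t" if u: "factor u t1" for u
  proof -
    obtain i where "occurs_at u t1 i" using u by (auto simp: factor_def)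
    then have "occurs_at (lext a u @ [a]) s (length (lext a (stake i t1)))"
      unfolding s[symmetric] linf_occurs_at by blast
    then obtain k where k: "occurs_at (lext a u @ [a]) s k" by blast
    show ?thesis
    proof (cases "e \<le> k")
      case True
      then have "occurs_at (lext a u @ [a]) t (k - e)" using k ts by (simp add: occurs_at_sdrop)
      then show ?thesis by (auto simp: factor_def)
    next
      case False
      then have e: "shd t \<noteq> a" "k = 0" by (auto simp: e_def split: if_splits)
      \<comment> \<open>The occurrence uses the prepended letter. Since \<open>shd t\<close> differs
        from \<open>a\<close>, every later return of a nonempty prefix of t is preceded by
        \<open>a\<close>; the extra letter makes r nonempty even for empty u.\<close>
      define r where "r = stake (Suc (length (rext a u))) t"
      have "occurs_at r t 0" by (simp add: occurs_at_def r_def del: stake.simps)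
      then obtain j where j: "1 \<le> j" "occurs_at r t j" by (rule recurrentD[OF rec])
      have "r = [shd t] @ stake (length (rext a u)) (stl t)" by (simp add: r_def)
      then have "occurs_at [shd t] t j" using j(2) by (simp only: occurs_at_append)
      then have "t !! Suc (j - 1) \<noteq> a" using e j(1) by (simp add: occurs_at_singleton)
      then have "t !! (j - 1) = a" using sep unfolding separating_def by blast
      then have "occurs_at ([a] @ r) t (j - 1)"
        unfolding occurs_at_append occurs_at_singleton using j by simp
      then have f: "factor (a # r) t" by (auto simp: factor_def)
      have "s = a ## t" using e by (simp add: s_def)
      then have "stake (length (rext a u)) t = rext a u"
        using k e unfolding lext_conj occurs_at_def by simp
      then have "r = rext a u @ [t !! length (rext a u)]" unfolding r_def stake_Suc by simp
      then have "prefix (a # rext a u) (a # r)" by simp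
      then show ?thesis unfolding lext_conj using f by (rule factor_prefix)
    qed
  qed
  have "factor (rev u) t1" if "factor u t1" for u
  proof -
    have "factor (rev (lext a u @ [a])) t" using epi fac2[OF that] by (simp only: episturmian_def)
    then show ?thesis unfolding rev_lext_snoc by (rule fac1)
  qed
  moreover have "u = u'"
    if rs: "right_special u t1" "right_special u' t1" "length u = length u'" for u u'
  proof -
    have lift: "right_special (lext a v @ [a]) t" if v: "right_special v t1" for v
    proof -
      have "factor ((lext a v @ [a]) @ [b]) t" if "factor (v @ [b]) t1" for b
      proof (rule factor_prefix[OF _ fac2[OF that]])
        show "prefix ((lext a v @ [a]) @ [b]) (lext a (v @ [b]) @ [a])" by simp
      qed
      then show ?thesis using v unfolding right_special_def by blast
    qed
    \<comment> \<open>The images may differ in length. A suffix of a right special word is right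
      special, so uniqueness makes the shorter image a suffix of the longer one; after reversal
      \<open>lext_prefix_cancel\<close> applies.\<close>
    have key: "x = y" if "right_special x t1" "right_special y t1" "length x = length y"
      "length (lext a x) \<le> length (lext a y)" for x y
    proof -
      let ?x = "lext a x @ [a]" and ?y = "lext a y @ [a]"
      define d where "d = length ?y - length ?x"
      have "right_special (take d ?y @ drop d ?y) t"
        unfolding append_take_drop_id using lift[OF that(2)] .
      then have "right_special (drop d ?y) t" by (rule right_special_appendD)
      moreover have "length (drop d ?y) = length ?x" using that(4) by (simp add: d_def)
      ultimately have "drop d ?y = ?x"
        using lift[OF that(1)] epi unfolding episturmian_def Uniq_def by blast
      then have "?y = take d ?y @ ?x" by (metis append_take_drop_id)
      then have "rev ?y = rev ?x @ rev (take d ?y)" by (metis rev_append)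
      then have "prefix (rev ?x) (rev ?y)" by (rule prefixI)
      then have "prefix (rev x) (rev y)" unfolding rev_lext_snoc by (rule lext_prefix_cancel)
      then obtain r where r: "rev y = rev x @ r" by (rule prefixE)
      have "length (rev y) = length (rev x @ r)" using r by (rule arg_cong)
      then have "r = []" using that(3) by simp
      then show "x = y" using r by simp
    qed
    show ?thesis using key[of u u'] key[of u' u] rs by (metis nat_le_linear)
  qed
  ultimately have "episturmian t1" unfolding episturmian_def Uniq_def by blast
  moreover have "e \<le> 1" by (simp add: e_def)
  ultimately show ?thesis using that ts s by blast
qed

lemma mu_letter_inf_eq_sdrop:
  "extend_inf (mu_letter x) t = sdrop (if is_R x then 1 else 0) (linf (base x) t)"
  by (cases x) (simp_all add: linf_eq_rinf)

lemma episturmian_desubstitution_spinned: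
  assumes "episturmian t"
  obtains x t1 where "t = extend_inf (mu_letter x) t1" "episturmian t1"
proof -
  obtain a e t1 where e: "e \<le> 1" "t = sdrop e (linf a t1)" "episturmian t1"
    using episturmian_desubstitution[OF assms] .
  have "t = extend_inf (mu_letter (if e = 0 then Spin_L a else Spin_R a)) t1"
    using e(1,2) unfolding mu_letter_inf_eq_sdrop by (cases "e = 0") (auto simp: le_Suc_eq)
  then show ?thesis using that e(3) by blast
qed

subsection \<open>Directive words\<close>

lemma directs_recurrent: "directs \<Delta> t \<Longrightarrow> recurrent t"
  by (auto simp: directs_def)

lemma directs_Stream:
  "directs (x ## \<Delta>) t \<longleftrightarrow>
     recurrent t \<and> (\<exists>t1. t = extend_inf (mu_letter x) t1 \<and> directs \<Delta> t1)"
proof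
  assume "directs (x ## \<Delta>) t"
  then obtain T where T: "T 0 = t" "\<And>n. recurrent (T n)"
    "\<And>n. T n = extend_inf (mu_letter ((x ## \<Delta>) !! n)) (T (Suc n))"
    unfolding directs_def by blast
  have t: "t = extend_inf (mu_letter x) (T 1)" using T(1) T(3)[of 0] by simp
  have step: "T (Suc n) = extend_inf (mu_letter (\<Delta> !! n)) (T (Suc (Suc n)))" for n
    using T(3)[of "Suc n"] by simp
  have "directs \<Delta> (T 1)"
    unfolding directs_def
    by (rule exI[of _ "\<lambda>n. T (Suc n)"]) (intro conjI allI T(2) step, simp)
  moreover have "recurrent t" using T(2)[of 0] unfolding T(1) .
  ultimately show "recurrent t \<and> (\<exists>t1. t = extend_inf (mu_letter x) t1 \<and> directs \<Delta> t1)"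
    using t by (intro conjI exI[of _ "T 1"])
next
  assume "recurrent t \<and> (\<exists>t1. t = extend_inf (mu_letter x) t1 \<and> directs \<Delta> t1)"
  then obtain t1 T where T: "recurrent t" "t = extend_inf (mu_letter x) t1" "T 0 = t1"
    "\<And>n. recurrent (T n)" "\<And>n. T n = extend_inf (mu_letter (\<Delta> !! n)) (T (Suc n))"
    unfolding directs_def by blast
  have "recurrent (case_nat t T n)" for n using T(1,4) by (cases n) simp_all
  moreover have "case_nat t T n = extend_inf (mu_letter ((x ## \<Delta>) !! n)) (case_nat t T (Suc n))" for n
    using T(2,3) T(5)[of "n - 1"] by (cases n) simp_all
  ultimately show "directs (x ## \<Delta>) t"
    unfolding directs_def by (intro exI[of _ "case_nat t T"]) simp
qed

lemma directs_shift:
  "directs (ws @- \<Delta>) t \<longleftrightarrow> (\<exists>t'. directs \<Delta> t' \<and> t = mu_inf ws t')"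
proof (induction ws arbitrary: t)
  case (Cons x ws)
  show ?case
  proof
    assume "directs ((x # ws) @- \<Delta>) t"
    then show "\<exists>t'. directs \<Delta> t' \<and> t = mu_inf (x # ws) t'"
      using Cons.IH by (auto simp: directs_Stream)
  next
    assume "\<exists>t'. directs \<Delta> t' \<and> t = mu_inf (x # ws) t'"
    then obtain t' where t': "directs \<Delta> t'" "t = mu_inf (x # ws) t'" by blast
    have "recurrent t" unfolding t'(2) by (rule recurrent_mu_inf[OF directs_recurrent[OF t'(1)]])
    then show "directs ((x # ws) @- \<Delta>) t"
      using Cons.IH t' by (auto simp: directs_Stream)
  qed
qed simp

lemma episturmian_directed:
  assumes "episturmian t" shows "\<exists>\<Delta>. directs \<Delta> t"
proof -
  have "\<exists>T. \<forall>n. (episturmian (T n) \<and> (n = 0 \<longrightarrow> T n = t)) \<and>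
      (\<exists>x. T n = extend_inf (mu_letter x) (T (Suc n)))"
  proof (rule dependent_nat_choice)
    show "\<exists>s. episturmian s \<and> ((0::nat) = 0 \<longrightarrow> s = t)" using assms by blast
  next
    fix s :: "'a stream" and n :: nat
    assume "episturmian s \<and> (n = 0 \<longrightarrow> s = t)"
    then have "episturmian s" by simp
    then obtain x s1 where "s = extend_inf (mu_letter x) s1" "episturmian s1"
      by (rule episturmian_desubstitution_spinned)
    then show "\<exists>s1. (episturmian s1 \<and> (Suc n = 0 \<longrightarrow> s1 = t)) \<and>
        (\<exists>x. s = extend_inf (mu_letter x) s1)" by auto
  qed
  then obtain T where "\<forall>n. (episturmian (T n) \<and> (n = 0 \<longrightarrow> T n = t)) \<and>
      (\<exists>x. T n = extend_inf (mu_letter x) (T (Suc n)))" by (rule exE)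
  then have T: "\<And>n. episturmian (T n)" "T 0 = t"
    and "\<forall>n. \<exists>x. T n = extend_inf (mu_letter x) (T (Suc n))" by blast+
  from choice[OF this(3)] obtain x
    where x: "\<And>n. T n = extend_inf (mu_letter (x n)) (T (Suc n))" by blast
  have "T n = extend_inf (mu_letter (smap x nats !! n)) (T (Suc n))" for n
    using x[of n] by simp
  then have "directs (smap x nats) t"
    unfolding directs_def using T(1,2) episturmian_recurrent by blast
  then show ?thesis by blast
qed

section \<open>Letters of a directed word and distances under desubstitution\<close>

lemma sset_extend_inf:
  "(\<And>b. f b \<noteq> []) \<Longrightarrow> sset (extend_inf f t) = (\<Union>b\<in>sset t. set (f b))"
  unfolding extend_inf_def by (subst sset_flat) (auto simp: stream.set_map)

lemma mem_mu_letter: "b \<in> set (mu_letter x b)" and base_mem_mu_letter: "base x \<in> set (mu_letter x b)"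
  by (cases x; auto simp: L_morph_def R_morph_def)+

lemma sset_mu_letter_inf:
  "insert (base x) (sset t) \<subseteq> sset (extend_inf (mu_letter x) t)"
proof -
  have "sset (extend_inf (mu_letter x) t) = (\<Union>b\<in>sset t. set (mu_letter x b))"
    by (rule sset_extend_inf) simp
  moreover have "base x \<in> (\<Union>b\<in>sset t. set (mu_letter x b))"
    by (rule UN_I[OF shd_sset base_mem_mu_letter])
  moreover have "sset t \<subseteq> (\<Union>b\<in>sset t. set (mu_letter x b))"
    by (rule subsetI, erule UN_I, rule mem_mu_letter)
  ultimately show ?thesis by simp
qed

lemma sset_mu_inf: "set (map base ws) \<union> sset t \<subseteq> sset (mu_inf ws t)"
proof (induction ws)
  case (Cons x ws)
  then show ?case using sset_mu_letter_inf[of x "mu_inf ws t"] by auto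
qed simp

lemma stake_gap:
  assumes "i \<le> j"
  shows "length (extend f (stake j t)) =
    length (extend f (stake i t)) + length (extend f (stake (j - i) (sdrop i t)))"
proof -
  have "stake j t = stake i t @ stake (j - i) (sdrop i t)" using assms by simp
  then show ?thesis by (simp only: extend_append length_append)
qed

text \<open>Desubstitution never increases a distance, and decreases it if the first position
  carries a letter other than a. The two inductions on distances below rest on this.\<close>

lemma lext_gap:
  assumes "length (lext a (stake i t)) + d = length (lext a (stake j t))" "0 < d"
  shows "i < j" "j - i \<le> d" "t !! i \<noteq> a \<Longrightarrow> j - i < d"
proof -
  show ij: "i < j"
  proof (rule ccontr)
    assume "\<not> i < j"
    then show False using stake_gap[of j i "L_morph a" t] assms by simp
  qed
  let ?u = "stake (j - i) (sdrop i t)"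
  have len: "d = length (lext a ?u)" using stake_gap[of i j "L_morph a" t] assms ij by simp
  then show "j - i \<le> d" using length_lext_ge[of ?u a] by simp
  have "?u ! 0 = t !! i" using ij by (simp add: sdrop_snth)
  then have "t !! i \<in> set ?u" using ij by (metis length_stake nth_mem zero_less_diff)
  then show "j - i < d" if "t !! i \<noteq> a" using length_lext_gt[of "t !! i" ?u a] that len by simp
qed

text \<open>
  Each desubstitution by a letter other than \<open>b\<close> shortens the distance of two occurrences of \<open>b\<close>.
\<close>

lemma directs_sset: assumes "directs \<Delta> t" shows "sset t = base ` sset \<Delta>"
proof
  have False if "directs \<Delta> t" "b \<notin> base ` sset \<Delta>" "t !! i = b" "t !! (i + d) = b" "0 < d"
    for b i d and \<Delta> :: "'a spinned stream" and t
    using that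
  proof (induction d arbitrary: \<Delta> t i rule: less_induct)
    case (less d)
    obtain x \<Delta>' where \<Delta>: "\<Delta> = x ## \<Delta>'" by (cases \<Delta>)
    obtain t1 where t1: "t = extend_inf (mu_letter x) t1" "directs \<Delta>' t1"
      using less.prems(1) unfolding \<Delta> directs_Stream by blast
    define e :: nat where "e = (if is_R x then 1 else 0)"
    define a where "a = base x"
    have t: "t = sdrop e (linf a t1)" unfolding t1(1) mu_letter_inf_eq_sdrop e_def a_def ..
    have ab: "a \<noteq> b" "b \<notin> base ` sset \<Delta>'" using less.prems(2) by (auto simp: a_def \<Delta>)
    have at: "linf a t1 !! (e + i) = b" "linf a t1 !! (e + (i + d)) = b"
      using less.prems(3,4) unfolding t sdrop_snth by simp_all
    obtain i1 where i1: "e + i = Suc (length (lext a (stake i1 t1)))" "t1 !! i1 = b"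
      using linf_snth_neqD[of a t1 "e + i"] at(1) ab(1) by metis
    obtain j1 where j1: "e + (i + d) = Suc (length (lext a (stake j1 t1)))" "t1 !! j1 = b"
      using linf_snth_neqD[of a t1 "e + (i + d)"] at(2) ab(1) by metis
    have "length (lext a (stake i1 t1)) + d = length (lext a (stake j1 t1))"
      using i1(1) j1(1) by simp
    note gap = lext_gap[OF this less.prems(5)]
    have "j1 - i1 < d" using gap(3) i1(2) ab(1) by simp
    then show False
      using less.IH[of "j1 - i1" \<Delta>' t1 i1] t1(2) ab(2) i1(2) j1(2) gap(1) by simp
  qed
  note key = this
  show "sset t \<subseteq> base ` sset \<Delta>"
  proof
    fix b assume "b \<in> sset t"
    then obtain i where i: "t !! i = b" by (auto simp: sset_range)
    then obtain j where "Suc i \<le> j" "occurs_at [b] t j"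
      using recurrentD[OF directs_recurrent[OF assms], of "[b]" i] by (auto simp: occurs_at_singleton)
    then show "b \<in> base ` sset \<Delta>"
      using key[OF assms, of b i "j - i"] i by (auto simp: occurs_at_singleton)
  qed
next
  show "base ` sset \<Delta> \<subseteq> sset t"
  proof
    fix b assume "b \<in> base ` sset \<Delta>"
    then obtain n where n: "b = base (\<Delta> !! n)" by (auto simp: sset_range)
    have "directs (stake (Suc n) \<Delta> @- sdrop (Suc n) \<Delta>) t" unfolding stake_sdrop by (rule assms)
    then obtain t' where t': "t = mu_inf (stake (Suc n) \<Delta>) t'" unfolding directs_shift by blast
    have "stake (Suc n) \<Delta> ! n = \<Delta> !! n" by (rule stake_nth) simp
    then have "\<Delta> !! n \<in> set (stake (Suc n) \<Delta>)" by (metis length_stake lessI nth_mem)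
    then have "b \<in> set (map base (stake (Suc n) \<Delta>))" unfolding n set_map by (rule imageI)
    then show "b \<in> sset t" unfolding t' using sset_mu_inf[of "stake (Suc n) \<Delta>" t'] by blast
  qed
qed

text \<open>\<open>ipal w\<close> marks the starts of blocks, so a block start seen through T is
  also one seen through T'. From there on the two L-images coincide, and L-morphisms are
  injective.\<close>

lemma mu_inf_common_tail:
  assumes eq: "mu_inf ws T = mu_inf ws' T'" and base: "map base ws = map base ws'"
  shows "\<exists>i i'. sdrop i T = sdrop i' T'"
proof -
  define w where "w = map base ws"
  define k where "k = length (shifting_factor ws)"
  define k' where "k' = length (shifting_factor ws')"
  have eq': "sdrop k (lmu_inf w T) = sdrop k' (lmu_inf w T')"
    using eq unfolding mu_inf_eq_sdrop[of ws T] mu_inf_eq_sdrop[of ws' T'] k_def k'_def w_def base .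
  \<comment> \<open>The start of block number k. Blocks are nonempty, so it lies at or after the k
    deleted letters.\<close>
  define X where "X = length (lmu w (stake k T))"
  have kX: "k \<le> X" unfolding X_def using length_mu_ge[of "stake k T" "L_spinned w"] by simp
  have tail: "sdrop X (lmu_inf w T) = sdrop (X - k + k') (lmu_inf w T')"
    using arg_cong[OF eq', of "sdrop (X - k)"] kX by (simp add: add.commute)
  have "occurs_at (ipal w) (lmu_inf w T) X" unfolding ipal_occurs_at X_def by blast
  then have "occurs_at (ipal w) (lmu_inf w T') (X - k + k')" unfolding occurs_at_def tail .
  then obtain i' where i': "X - k + k' = length (lmu w (stake i' T'))" unfolding ipal_occurs_at by blast
  have "lmu_inf w (sdrop k T) = lmu_inf w (sdrop i' T')"
    using tail unfolding i' unfolding X_def sdrop_mu_inf .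
  then have "sdrop k T = sdrop i' T'" by (rule lmu_inf_inj)
  then show ?thesis by blast
qed

subsection \<open>Occurrences of a factor and palindromic prefixes\<close>

lemma separating_linf: "separating a (linf a t)"
  unfolding separating_def
proof (rule allI, rule disjCI)
  fix i assume "linf a t !! Suc i \<noteq> a"
  then obtain j where j: "Suc i = Suc (length (lext a (stake j t)))" by (rule linf_snth_neqD)
  show "linf a t !! i = a" using linf_snth_boundary[of a t j] j by simp
qed

lemma occurs_at_hd: "occurs_at q t j \<Longrightarrow> q \<noteq> [] \<Longrightarrow> t !! j = hd q"
  using occurs_at_append[of "[hd q]" "tl q" t j] by (simp add: occurs_at_singleton)

lemma occurs_at_last:
  assumes "occurs_at q t j" "q \<noteq> []"
  shows "t !! (j + length q - 1) = last q"
proof -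
  have "t !! (j + length (butlast q)) = last q"
    using assms occurs_at_append[of "butlast q" "[last q]" t j] by (simp add: occurs_at_singleton)
  moreover have "j + length (butlast q) = j + length q - 1" using assms(2) by (cases q) simp_all
  ultimately show ?thesis by (simp only:)
qed

text \<open>A letter other than the separating a has a on both sides, except that position 0 has no
  left neighbour; but position 0 carries a itself.\<close>

lemma linf_extend_occurrence:
  assumes occ: "occurs_at q (linf a t) j" and q: "q \<noteq> []"
  defines "l \<equiv> if hd q = a then [] else [a]" and "r \<equiv> if last q = a then [] else [a]"
  shows "length l \<le> j" "occurs_at (l @ q @ r) (linf a t) (j - length l)"
proof -
  note sep = separating_linf[of a t, unfolded separating_def, rule_format]
  have left: "length l \<le> j \<and> occurs_at l (linf a t) (j - length l)"
  proof (cases "hd q = a")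
    case False
    then have "linf a t !! j \<noteq> a" using occurs_at_hd[OF occ q] by simp
    moreover from this have "j \<noteq> 0" by (cases j) simp_all
    ultimately have "linf a t !! (j - 1) = a" using sep[of "j - 1"] by simp
    then show ?thesis using False \<open>j \<noteq> 0\<close> by (simp add: l_def occurs_at_singleton)
  qed (simp add: l_def occurs_at_def)
  moreover have "occurs_at r (linf a t) (j + length q)"
  proof (cases "last q = a")
    case False
    then have "linf a t !! (j + length q - 1) \<noteq> a" using occurs_at_last[OF occ q] by simp
    moreover have "Suc (j + length q - 1) = j + length q" using q by (cases q) simp_all
    ultimately have "linf a t !! (j + length q) = a" using sep[of "j + length q - 1"] by simp
    then show ?thesis using False by (simp add: r_def occurs_at_singleton)
  qed (simp add: r_def occurs_at_def)
  ultimately show "length l \<le> j" "occurs_at (l @ q @ r) (linf a t) (j - length l)"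
    using occ by (simp_all add: occurs_at_append)
qed

text \<open>Both end letters of p start blocks, so p consists of complete blocks and the opening
  letter of one more.\<close>

lemma linf_closed_word:
  assumes occ: "occurs_at p (linf a t) j" and p: "p \<noteq> []" "hd p = a" "last p = a"
  shows "\<exists>q. p = lext a q @ [a]"
proof (cases "length p = 1")
  case True
  then have "p = [a]" using p(2) by (cases p) auto
  then show ?thesis by (intro exI[of _ "[]"]) simp
next
  case False
  then have lp: "2 \<le> length p" using p(1) by (cases p) (auto simp: Suc_le_eq)
  obtain i where i: "j = length (lext a (stake i t))"
    using occurs_at_hd[OF occ p(1)] p(2) linf_snth_eqD[of a t j] by blast
  obtain i2 where i2: "j + length p - 1 = length (lext a (stake i2 t))"
    using occurs_at_last[OF occ p(1)] p(3) linf_snth_eqD[of a t "j + length p - 1"] by blast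
  have d: "length (lext a (stake i t)) + (length p - 1) = length (lext a (stake i2 t))"
    using i i2 lp by simp
  have "i < i2" using lext_gap(1)[OF d] lp by simp
  define u where "u = stake (i2 - i) (sdrop i t)"
  have lu: "length p - 1 = length (lext a u)"
    using stake_gap[of i i2 "L_morph a" t] d \<open>i < i2\<close> unfolding u_def by simp
  have pb: "p = butlast p @ [a]" using p(1,3) append_butlast_last_id by metis
  then have "occurs_at (butlast p) (linf a t) j" using occ occurs_at_append[of "butlast p" "[a]"] by simp
  then have "butlast p = stake (length p - 1) (linf a (sdrop i t))"
    unfolding occurs_at_def i sdrop_linf by simp
  also have "\<dots> = lext a u"
    unfolding lu u_def using stake_mu_inf[of "[Spin_L a]" "i2 - i" "sdrop i t"] by simp
  finally show ?thesis using pb by metis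
qed

lemma set_lext: "set (lext a u) \<subseteq> insert a (set u)"
  by (induction u) auto

lemma stake_ipal: "k \<le> length (ipal w) \<Longrightarrow> stake k (lmu_inf w t) = take k (ipal w)"
proof -
  assume k: "k \<le> length (ipal w)"
  have "occurs_at (ipal w) (lmu_inf w t) 0"
    unfolding ipal_occurs_at by (rule exI[of _ 0]) simp
  then have "ipal w = stake (length (ipal w)) (lmu_inf w t)" by (simp add: occurs_at_def)
  then have "take k (ipal w) = take k (stake (length (ipal w)) (lmu_inf w t))" by (rule arg_cong)
  then show ?thesis using k by (simp add: take_stake min_def)
qed

text \<open>
  The induction terminates because desubstitution shortens \<open>q\<close>, unless \<open>q\<close> begins with a
  letter other than the separating one, in which case it brings two occurrences of \<open>q\<close>
  closer together.
\<close>

lemma occurrence_desubstitution: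
  assumes "episturmian t" "occurs_at q t i" "occurs_at q t (i + d)" "0 < d"
  shows "\<exists>u t' k f g. episturmian t' \<and> k \<le> length (ipal u) \<and> t = sdrop k (lmu_inf u t') \<and>
    ipal u = f @ q @ g \<and>
    (\<forall>j. occurs_at q t j \<longrightarrow> (\<exists>i. j + k = length (lmu u (stake i t')) + length f))"
  using assms
proof (induction "length q + d" arbitrary: q t i d rule: less_induct)
  case less
  show ?case
  proof (cases "q = []")
    case True
    then show ?thesis
      using less.prems(1)
      by (intro exI[of _ "[]"] exI[of _ t] exI[of _ 0]) simp
  next
    case q: False
    obtain a e t1 where e: "e \<le> 1" "t = sdrop e (linf a t1)" and epi: "episturmian t1"
      using episturmian_desubstitution[OF less.prems(1)] .
    define l where "l = (if hd q = a then [] else [a])"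
    define r where "r = (if last q = a then [] else [a])"
    define p where "p = l @ q @ r"
    have ext: "length l \<le> e + j \<and> occurs_at p (linf a t1) (e + j - length l)"
      if "occurs_at q t j" for j
      using linf_extend_occurrence[of q a t1 "e + j"] that q unfolding e(2) occurs_at_sdrop p_def l_def r_def
      by blast
    have "p \<noteq> []" "hd p = a" "last p = a" using q by (auto simp: p_def l_def r_def)
    from linf_closed_word[OF conjunct2[OF ext[OF less.prems(2)]] this]
    obtain q1 where q1: "p = lext a q1 @ [a]" by blast
    have occ: "\<exists>i1. e + j = length l + length (lext a (stake i1 t1)) \<and> occurs_at q1 t1 i1"
      if "occurs_at q t j" for j
    proof -
      have "length l \<le> e + j" "occurs_at (lext a q1 @ [a]) (linf a t1) (e + j - length l)"
        using ext[OF that] unfolding q1 by blast+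
      then obtain i1 where "e + j - length l = length (lext a (stake i1 t1))" "occurs_at q1 t1 i1"
        unfolding linf_occurs_at by blast
      then show ?thesis using \<open>length l \<le> e + j\<close> by (intro exI[of _ i1]) simp
    qed
    obtain i1 where i1: "e + i = length l + length (lext a (stake i1 t1))" "occurs_at q1 t1 i1"
      using occ[OF less.prems(2)] by blast
    obtain j1 where j1: "e + (i + d) = length l + length (lext a (stake j1 t1))" "occurs_at q1 t1 j1"
      using occ[OF less.prems(3)] by blast
    have "length (lext a (stake i1 t1)) + d = length (lext a (stake j1 t1))"
      using i1(1) j1(1) by simp
    note gap = lext_gap[OF this less.prems(4)]
    have lenp: "length (lext a q1) + 1 = length l + length q + length r"
      using arg_cong[OF q1, of length] by (simp add: p_def)
    have "length q1 + (j1 - i1) < length q + d"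
    proof (cases "hd q = a")
      case True
      then have l: "l = []" by (simp add: l_def)
      have "length q1 < length q"
      proof (cases "last q = a")
        case True
        then show ?thesis using lenp l length_lext_ge[of q1 a] by (simp add: r_def)
      next
        case False
        then have "q = lext a q1" using q1 l by (simp add: p_def r_def)
        moreover from this have "last q \<in> set q1" using set_lext[of a q1] False last_in_set[OF q] by auto
        ultimately show ?thesis using length_lext_gt[of "last q" q1 a] False by simp
      qed
      then show ?thesis using gap(2) by simp
    next
      case False
      then have l: "l = [a]" by (simp add: l_def)
      have p': "a # q @ r = lext a q1 @ [a]" using q1 l by (simp add: p_def)
      obtain c q2 where c: "q1 = c # q2" using p' q by (cases q1) auto
      have "c \<noteq> a"
      proof
        assume "c = a"
        then have "q @ r = a # rext a q2" using p' c by (simp add: lext_conj)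
        then show False using q False by (cases q) auto
      qed
      moreover have "t1 !! i1 = c" using occurs_at_hd[OF i1(2)] c by simp
      ultimately have "j1 - i1 < d" using gap(3) by simp
      moreover have "length q1 < length (lext a q1)"
        using length_lext_gt[of c q1 a] \<open>c \<noteq> a\<close> c by simp
      moreover have "length r \<le> 1" by (simp add: r_def)
      ultimately show ?thesis using lenp l by simp
    qed
    moreover have "occurs_at q1 t1 (i1 + (j1 - i1))" using j1(2) gap(1) by simp
    ultimately obtain u1 t' k1 f1 g1 where
      IH: "episturmian t'" "k1 \<le> length (ipal u1)" "t1 = sdrop k1 (lmu_inf u1 t')"
        "ipal u1 = f1 @ q1 @ g1"
        "\<And>j. occurs_at q1 t1 j \<Longrightarrow> \<exists>i. j + k1 = length (lmu u1 (stake i t')) + length f1"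
      using less.hyps[of q1 "j1 - i1" t1 i1] epi i1(2) gap(1) by auto
    define X where "X = lmu_inf u1 t'"
    \<comment> \<open>The preimage of these k deleted letters is the deleted prefix of X. The
      possible extra letter e \<le> 1 is accommodated by the final \<open>a\<close> of
      \<open>ipal (a # u1)\<close>.\<close>
    define k where "k = length (lext a (stake k1 X)) + e"
    define f where "f = lext a f1 @ l"
    have "stake k1 X = take k1 (ipal u1)" unfolding X_def using IH(2) by (rule stake_ipal)
    then have "prefix (stake k1 X) (ipal u1)" by (simp add: take_is_prefix)
    then have "length (lext a (stake k1 X)) \<le> length (lext a (ipal u1))"
      by (intro prefix_length_le extend_prefix)
    then have "k \<le> length (ipal (a # u1))" using e(1) by (simp add: k_def)
    moreover have "t = sdrop k (lmu_inf (a # u1) t')"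
    proof -
      have "sdrop k (linf a X) = sdrop e (sdrop (length (lext a (stake k1 X))) (linf a X))"
        by (simp add: k_def)
      also have "\<dots> = t" unfolding sdrop_linf e(2) IH(3) X_def ..
      finally show ?thesis by (simp add: X_def)
    qed
    moreover have "ipal (a # u1) = f @ q @ (r @ rext a g1)"
    proof -
      have "ipal (a # u1) = lext a f1 @ lext a q1 @ (lext a g1 @ [a])" by (simp add: IH(4))
      also have "\<dots> = lext a f1 @ (lext a q1 @ [a]) @ rext a g1" unfolding lext_conj[of a g1] by simp
      also have "\<dots> = f @ q @ (r @ rext a g1)" by (simp add: f_def p_def flip: q1)
      finally show ?thesis .
    qed
    moreover have "\<exists>i. j + k = length (lmu (a # u1) (stake i t')) + length f"
      if j: "occurs_at q t j" for j
    proof -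
      obtain m where m: "e + j = length l + length (lext a (stake m t1))" "occurs_at q1 t1 m"
        using occ[OF j] by blast
      obtain n where n: "m + k1 = length (lmu u1 (stake n t')) + length f1"
        using IH(5)[OF m(2)] by blast
      \<comment> \<open>One prefix of X read in two ways: the deleted part followed by m letters of
        t1, or n complete blocks followed by f1. Applying L_a and comparing lengths transfers the
        position formula one level up.\<close>
      have "stake k1 X @ stake m t1 = stake (length (lmu u1 (stake n t')) + length f1) X"
        unfolding IH(3) X_def n[symmetric] by (simp add: add.commute)
      also have "\<dots> = stake (length (lmu u1 (stake n t'))) X @
          stake (length f1) (sdrop (length (lmu u1 (stake n t'))) X)"
        by simp
      also have "\<dots> = lmu u1 (stake n t') @ stake (length f1) (lmu_inf u1 (sdrop n t'))"
        unfolding X_def stake_mu_inf sdrop_mu_inf ..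
      also have "stake (length f1) (lmu_inf u1 (sdrop n t')) = f1"
        by (subst stake_ipal) (simp_all add: IH(4))
      finally have "lext a (stake k1 X) @ lext a (stake m t1) = lext a (lmu u1 (stake n t')) @ lext a f1"
        using extend_append by metis
      from arg_cong[OF this, of length]
      have "length (lext a (stake k1 X)) + length (lext a (stake m t1)) =
          length (lext a (lmu u1 (stake n t'))) + length (lext a f1)" by simp
      then show ?thesis using m(1) by (intro exI[of _ n]) (simp add: k_def f_def)
    qed
    ultimately show ?thesis using IH(1) by blast
  qed
qed

subsection \<open>Quasiperiods\<close>

lemma quasiperiod_iff:
  "quasiperiod q t \<longleftrightarrow> (\<exists>X :: nat \<Rightarrow> nat. X 0 = 0 \<and>
     (\<forall>n. X n < X (Suc n) \<and> X (Suc n) \<le> X n + length q \<and> occurs_at q t (X n)))"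
proof
  assume "quasiperiod q t"
  then obtain p where p: "p 0 = []" "\<And>n. length (p n) < length (p (Suc n))"
    "\<And>n. length (p (Suc n)) \<le> length (p n @ q)" "\<And>n. prefix_inf (p n @ q) t"
    unfolding quasiperiod_def by blast
  have "occurs_at q t (length (p n))" for n
  proof -
    obtain s where "t = (p n @ q) @- s" using p(4) unfolding prefix_inf_def by blast
    then show ?thesis by (auto simp: occurs_at_iff sdrop_shift)
  qed
  then show "\<exists>X :: nat \<Rightarrow> nat. X 0 = 0 \<and>
     (\<forall>n. X n < X (Suc n) \<and> X (Suc n) \<le> X n + length q \<and> occurs_at q t (X n))"
    using p(1-3) by (intro exI[of _ "\<lambda>n. length (p n)"]) simp
next
  assume "\<exists>X :: nat \<Rightarrow> nat. X 0 = 0 \<and>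
     (\<forall>n. X n < X (Suc n) \<and> X (Suc n) \<le> X n + length q \<and> occurs_at q t (X n))"
  then obtain X :: "nat \<Rightarrow> nat" where X: "X 0 = 0" "\<And>n. X n < X (Suc n)"
    "\<And>n. X (Suc n) \<le> X n + length q" "\<And>n. occurs_at q t (X n)" by blast
  have "prefix_inf (stake (X n) t @ q) t" for n
  proof -
    obtain s where "sdrop (X n) t = q @- s" using X(4) unfolding occurs_at_iff by blast
    then have "t = (stake (X n) t @ q) @- s" using stake_sdrop[of "X n" t] by simp
    then show ?thesis unfolding prefix_inf_def by blast
  qed
  then show "quasiperiod q t"
    unfolding quasiperiod_def using X(1-3)
    by (intro exI[of _ "\<lambda>n. stake (X n) t"]) simp
qed

lemma quasiperiod_covers:
  assumes "quasiperiod q t"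
  shows "\<exists>j\<le>n. n < j + length q \<and> occurs_at q t j"
proof -
  obtain X :: "nat \<Rightarrow> nat" where X: "X 0 = 0" "\<And>n. X n < X (Suc n)"
    "\<And>n. X (Suc n) \<le> X n + length q" "\<And>n. occurs_at q t (X n)"
    using assms unfolding quasiperiod_iff by blast
  have "\<exists>m. X m \<le> n \<and> n < X (Suc m)"
  proof (induction n)
    case 0
    show ?case using X(1) X(2)[of 0] by (intro exI[of _ 0]) simp
  next
    case (Suc n)
    then obtain m where m: "X m \<le> n" "n < X (Suc m)" by blast
    show ?case
    proof (cases "Suc n < X (Suc m)")
      case True
      then show ?thesis using m by (intro exI[of _ m]) simp
    next
      case False
      then show ?thesis using m X(2)[of "Suc m"] by (intro exI[of _ "Suc m"]) simp
    qed
  qed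
  then obtain m where "X m \<le> n" "n < X (Suc m)" by blast
  then show ?thesis using X(3)[of m] X(4)[of m] by (intro exI[of _ "X m"]) simp
qed

lemma quasiperiod_prefix: "quasiperiod q t \<Longrightarrow> occurs_at q t 0 \<and> q \<noteq> []"
  using quasiperiod_covers[of q t 0] by auto

lemma length_lmu_stake_Suc:
  "length (lmu u (stake (Suc n) t)) = length (lmu u (stake n t)) + length (lmu u [t !! n])"
  unfolding stake_Suc by simp

lemma length_lmu_stake_less: "length (lmu u (stake n t)) < length (lmu u (stake (Suc n) t))"
  unfolding length_lmu_stake_Suc using length_mu_ge[of "[t !! n]" "L_spinned u"]
  by (simp add: Suc_le_eq)

lemma length_lmu_stake_mono:
  "m \<le> n \<Longrightarrow> length (lmu u (stake m t)) \<le> length (lmu u (stake n t))"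
  by (rule lift_Suc_mono_le[of "\<lambda>n. length (lmu u (stake n t))"])
    (use length_lmu_stake_less in \<open>auto intro: less_imp_le\<close>)

text \<open>Locates the words of the theorem inside Pal(wv): they begin right after the shifting
  factor, and the remainder of Pal(w) is the room available for p.\<close>

lemma ipal_append_shifted:
  "ipal (map base ws @ v) = shifting_factor ws @ mu ws (ipal v) @
     drop (length (shifting_factor ws)) (ipal (map base ws))"
proof -
  obtain r where r: "ipal (map base ws) = shifting_factor ws @ r"
    using shifting_factor_prefix[of ws] by (rule prefixE)
  have "ipal (map base ws @ v) = (lmu (map base ws) (ipal v) @ shifting_factor ws) @ r"
    unfolding ipal_append r by simp
  also have "\<dots> = shifting_factor ws @ mu ws (ipal v) @ r"
    unfolding shifting_factor_conj[symmetric] by simp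
  finally show ?thesis unfolding r by simp
qed

lemma length_mu_ipal_ge:
  assumes "b \<in> set v"
  shows "length (lmu (map base ws @ v) [b]) \<le> length (mu ws (ipal v))"
proof -
  have "prefix (lmu (map base ws) (lmu v [b])) (lmu (map base ws) (ipal v))"
    by (rule mu_prefix[OF lmu_letter_prefix[OF assms]])
  then show ?thesis by (simp only: length_mu[of ws] map_append mu_append prefix_length_le)
qed

lemma length_mu_ipal_first:
  assumes "d \<notin> set v"
  shows "length (mu ws (ipal (d # v))) = length (lmu (map base ws @ d # v) [d])"
  using lmu_first_letter[OF assms] by (simp only: length_mu[of ws] map_append mu_append)

text \<open>By \<open>directs_sset\<close> the condition on Alph(v), which concerns the directive
  word, becomes a condition on the letters of the desubstituted word T.\<close>

lemma decompositionD:
  assumes "decomposition t w ws v y ys"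
  obtains T where "map base ws = w" "recurrent T" "t = mu_inf (ws @ L_spinned v) T"
    "sset T = sset y" "sset T \<subseteq> set v"
proof -
  have dec: "map base ws = w" "smap base ys = y" "directs ((ws @ L_spinned v) @- ys) t"
    "set v = set v \<union> sset y"
    using assms by (simp_all add: decomposition_def spinned_version_def spinned_version_inf_def)
  obtain T where T: "directs ys T" "t = mu_inf (ws @ L_spinned v) T"
    using dec(3) unfolding directs_shift by blast
  have "sset T = sset y" using directs_sset[OF T(1)] dec(2) by (auto simp: stream.set_map)
  then show ?thesis using that[of T] dec T directs_recurrent by blast
qed

lemma decomposition_quasiperiod:
  assumes dec: "decomposition t w ws v y ys"
    and p: "prefix p (drop (length (shifting_factor ws)) (ipal w))"
  shows "quasiperiod (mu ws (ipal v) @ p) t"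
proof -
  obtain T where T: "map base ws = w" "t = mu_inf (ws @ L_spinned v) T" "sset T \<subseteq> set v"
    using decompositionD[OF dec] .
  define u where "u = w @ v"
  define k where "k = length (shifting_factor ws)"
  define q where "q = mu ws (ipal v) @ p"
  have t: "t = sdrop k (lmu_inf u T)"
    unfolding T(2) mu_inf_eq_sdrop[of "ws @ L_spinned v"] using T(1) by (simp add: k_def u_def)
  obtain g where g: "drop k (ipal w) = p @ g" using p unfolding k_def by (rule prefixE)
  have ipal: "ipal u = shifting_factor ws @ q @ g"
    using ipal_append_shifted[of ws v] g unfolding u_def q_def k_def T(1) by simp
  \<comment> \<open>The deleted letters and the shifting factor in front of q have the same length
    k, so q occurs in t at the very positions where the blocks start in the L-image.\<close>
  have occ: "occurs_at q t (length (lmu u (stake n T)))" for n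
  proof -
    have "occurs_at (shifting_factor ws @ q @ g) (lmu_inf u T) (length (lmu u (stake n T)))"
      unfolding ipal[symmetric] ipal_occurs_at by blast
    then show ?thesis
      unfolding t occurs_at_sdrop by (simp add: occurs_at_append k_def add.commute)
  qed
  have gap: "length (lmu u [T !! n]) \<le> length q" for n
  proof -
    have "T !! n \<in> set v" using T(3) snth_sset[of T n] by blast
    then show ?thesis
      using length_mu_ipal_ge[of "T !! n" v ws] unfolding T(1) u_def q_def by simp
  qed
  have "quasiperiod q t"
    unfolding quasiperiod_iff
  proof (intro exI[of _ "\<lambda>n. length (lmu u (stake n T))"] conjI allI)
    show "length (lmu u (stake 0 T)) = 0" by simp
    show "length (lmu u (stake n T)) < length (lmu u (stake (Suc n) T))" for n
      by (rule length_lmu_stake_less)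
    show "length (lmu u (stake (Suc n) T)) \<le> length (lmu u (stake n T)) + length q" for n
      unfolding length_lmu_stake_Suc using gap by simp
  qed (rule occ)
  then show ?thesis by (simp add: q_def)
qed

section \<open>From a quasiperiod to a decomposition\<close>

lemma episturmian_sdrop:
  assumes "episturmian t" shows "episturmian (sdrop k t)"
  using assms unfolding episturmian_def right_special_def
    factor_sdrop_iff[OF episturmian_recurrent[OF assms]] .

lemma shortest_covering_suffix:
  assumes "A \<subseteq> set u" "A \<noteq> {}"
  obtains w c v where "u = w @ c # v" "A \<subseteq> set (c # v)" "c \<in> A" "c \<notin> set v"
  using assms
proof (induction u arbitrary: thesis)
  case (Cons c u)
  show ?case
  proof (cases "A \<subseteq> set u")
    case True
    then obtain w d v where "u = w @ d # v" "A \<subseteq> set (d # v)" "d \<in> A" "d \<notin> set v"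
      using Cons.IH Cons.prems(3) by blast
    then show ?thesis using Cons.prems(1)[of "c # w"] by simp
  next
    case False
    then show ?thesis using Cons.prems(1)[of "[]" c u] Cons.prems(2) by auto
  qed
qed simp

lemma quasiperiod_decomposition:
  assumes epi: "episturmian t" and qp: "quasiperiod q t"
  shows "\<exists>w ws v y ys p. q = mu ws (ipal v) @ p \<and> decomposition t w ws v y ys \<and>
    prefix p (drop (length (shifting_factor ws)) (ipal w))"
proof -
  have q0: "occurs_at q t 0" "q \<noteq> []" using quasiperiod_prefix[OF qp] by blast+
  obtain d where d: "1 \<le> d" "occurs_at q t d"
    using recurrentD[OF episturmian_recurrent[OF epi] q0(1)] .
  have "\<exists>u t' k f g. episturmian t' \<and> k \<le> length (ipal u) \<and> t = sdrop k (lmu_inf u t') \<and>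
    ipal u = f @ q @ g \<and>
    (\<forall>j. occurs_at q t j \<longrightarrow> (\<exists>i. j + k = length (lmu u (stake i t')) + length f))"
    by (rule occurrence_desubstitution[OF epi q0(1), of d]) (use d in simp_all)
  then obtain u t' k f g where
    u: "episturmian t'" "t = sdrop k (lmu_inf u t')" "ipal u = f @ q @ g"
      "\<And>j. occurs_at q t j \<Longrightarrow> \<exists>i. j + k = length (lmu u (stake i t')) + length f" by blast
  define X where "X i = length (lmu u (stake i t'))" for i
  \<comment> \<open>The occurrence of q at 0 shows that t starts \<open>length f\<close> letters
    after the start of block i0. So occurrences of q in t sit at positions
    \<open>X l - X i0\<close>.\<close>
  obtain i0 where i0: "k = X i0 + length f" using u(4)[OF q0(1)] unfolding X_def by auto
  have gap: "length (lmu u [b]) \<le> length q" if b: "b \<in> sset t'" for b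
  proof -
    obtain i' where "occurs_at [b] t' i'" using b by (auto simp: occurs_at_singleton sset_range)
    then obtain i where i: "i0 \<le> i" "occurs_at [b] t' i"
      by (rule recurrentD[OF episturmian_recurrent[OF u(1)]])
    have Xi: "X (Suc i) = X i + length (lmu u [b])"
      using i(2) unfolding X_def length_lmu_stake_Suc occurs_at_singleton by simp
    have pos: "X i < X (Suc i)" unfolding X_def by (rule length_lmu_stake_less)
    have mono: "m \<le> n \<Longrightarrow> X m \<le> X n" for m n unfolding X_def by (rule length_lmu_stake_mono)
    \<comment> \<open>The position just before block \<open>Suc i\<close>. An occurrence of q
      covering it starts at a block start no later than that of block i, so q is at least as long as
      block i.\<close>
    obtain j where j: "j \<le> X (Suc i) - X i0 - 1" "X (Suc i) - X i0 - 1 < j + length q"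
      "occurs_at q t j"
      using quasiperiod_covers[OF qp, of "X (Suc i) - X i0 - 1"] by blast
    obtain l where "j + k = X l + length f" using u(4)[OF j(3)] unfolding X_def by blast
    then have l: "j + X i0 = X l" using i0 by simp
    have "X l < X (Suc i)" using l j(1) mono[OF i(1)] pos by simp
    then have "l \<le> i" using mono[of "Suc i" l] by (meson leD not_less_eq_eq)
    then show ?thesis using mono[of l i] l j(2) Xi mono[OF i(1)] pos by linarith
  qed
  have in_u: "sset t' \<subseteq> set u"
  proof (rule subsetI, rule ccontr)
    fix b assume "b \<in> sset t'" "b \<notin> set u"
    \<comment> \<open>The block of such b would be Pal(u)b, which is longer than q, a factor of
      Pal(u).\<close>
    then show False using gap[of b] lmu_letter_notin[of b u] u(3) by simp
  qed
  have "sset t' \<noteq> {}" using shd_sset by blast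
  with in_u obtain w c v1 where wv: "u = w @ c # v1" "sset t' \<subseteq> set (c # v1)" "c \<in> sset t'" "c \<notin> set v1"
    by (rule shortest_covering_suffix)
  define v where "v = c # v1"
  have "length (ipal u) = length (lmu w (ipal v)) + length (ipal w)"
    unfolding wv(1) v_def ipal_append by simp
  moreover have len: "length (lmu w (ipal v)) \<le> length q"
    using gap[OF wv(3)] lmu_first_letter[OF wv(4)] unfolding wv(1) v_def
    by (simp only: map_append mu_append)
  \<comment> \<open>q uses up at least |\<mu>\<open>\<^sub>w\<close>(Pal(v))| letters of Pal(u), so
    at most |Pal(w)| are left for f.\<close>
  ultimately have "length f \<le> length (ipal w)" using u(3) by simp
  then obtain ws where ws: "map base ws = w" "length (shifting_factor ws) = length f"
    using shifting_factor_of_length by blast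
  define t'' where "t'' = sdrop i0 t'"
  have "episturmian t''" unfolding t''_def by (rule episturmian_sdrop[OF u(1)])
  then obtain ys where ys: "directs ys t''" using episturmian_directed by blast
  have "t = sdrop (length f) (sdrop (X i0) (lmu_inf u t'))" unfolding u(2) i0 by simp
  also have "\<dots> = sdrop (length f) (lmu_inf u t'')" unfolding X_def sdrop_mu_inf t''_def ..
  also have "\<dots> = mu_inf (ws @ L_spinned v) t''"
    unfolding mu_inf_eq_sdrop[of "ws @ L_spinned v"] using ws by (simp add: wv(1) flip: v_def)
  finally have "directs ((ws @ L_spinned v) @- ys) t" unfolding directs_shift using ys by blast
  moreover have "base ` sset ys = sset t'"
    using directs_sset[OF ys] sset_sdrop_recurrent[OF episturmian_recurrent[OF u(1)]]
    by (simp add: t''_def)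
  ultimately have dec: "decomposition t w ws v (smap base ys) ys"
    using ws(1) wv(2)
    by (auto simp: decomposition_def spinned_version_def spinned_version_inf_def v_def stream.set_map)
  define r where "r = drop (length (shifting_factor ws)) (ipal w)"
  have "f @ q @ g = shifting_factor ws @ mu ws (ipal v) @ r"
    using ipal_append_shifted[of ws v] u(3) unfolding ws(1) r_def wv(1) v_def by simp
  then have qg: "q @ g = mu ws (ipal v) @ r" using ws(2) by simp
  have "length (mu ws (ipal v)) \<le> length q" using len unfolding length_mu[of ws] ws(1) .
  then have "prefix (mu ws (ipal v)) q"
    by (rule prefix_length_prefix[OF prefixI[OF qg] prefixI[OF refl]])
  then obtain p where p: "q = mu ws (ipal v) @ p" by (rule prefixE)
  have "prefix p r" using qg unfolding p by (auto simp: prefix_def)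
  then show ?thesis using p dec unfolding r_def by blast
qed

subsection \<open>The smallest quasiperiod\<close>

lemma length_lmu_letter_mono: "d \<in> set u \<Longrightarrow> length (lmu w [d]) \<le> length (lmu w u)"
proof -
  assume "d \<in> set u"
  then obtain x y where "u = x @ [d] @ y" by (metis append_Cons append_Nil split_list)
  then show ?thesis by (simp only: mu_append_right length_append)
qed

text \<open>A letter d of \<mu>\<open>\<^sub>x\<close>(b) also occurs in L_x(b), so its block under
  w is part of the block of b under wx.\<close>

lemma return_length_mono:
  assumes "d \<in> sset (mu_inf ws T)"
  shows "\<exists>d'\<in>sset T. length (lmu w [d]) \<le> length (lmu (w @ map base ws) [d'])"
  using assms
proof (induction ws arbitrary: w d)
  case (Cons x ws)
  have "sset (mu_inf (x # ws) T) = (\<Union>b\<in>sset (mu_inf ws T). set (mu_letter x b))"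
    using sset_extend_inf[of "mu_letter x" "mu_inf ws T"] by simp
  then obtain b where b: "b \<in> sset (mu_inf ws T)" "d \<in> set (mu_letter x b)"
    using Cons.prems by auto
  have "d \<in> set (lext (base x) [b])"
    using b(2) by (cases x) (auto simp: L_morph_def R_morph_def split: if_splits)
  then have "length (lmu w [d]) \<le> length (lmu w (lext (base x) [b]))" by (rule length_lmu_letter_mono)
  also have "\<dots> = length (lmu (w @ [base x]) [b])" unfolding map_append mu_append by simp
  finally have 1: "length (lmu w [d]) \<le> length (lmu (w @ [base x]) [b])" .
  obtain d' where "d' \<in> sset T" "length (lmu (w @ [base x]) [b]) \<le> length (lmu ((w @ [base x]) @ map base ws) [d'])"
    using Cons.IH[OF b(1), of "w @ [base x]"] by blast
  then show ?case using 1 by (intro bexI[of _ d']) simp_all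
qed auto

lemma base_common_prefix:
  assumes "length ws \<le> length ws'"
  shows "(\<exists>ws1 ws2. ws' = ws1 @ ws2 \<and> map base ws1 = map base ws) \<or>
    (\<exists>zs x rs zs' x' rs'. ws = zs @ x # rs \<and> ws' = zs' @ x' # rs' \<and>
       map base zs = map base zs' \<and> base x \<noteq> base x')"
  using assms
proof (induction ws arbitrary: ws')
  case (Cons x ws)
  then obtain x' xs where ws': "ws' = x' # xs" "length ws \<le> length xs" by (cases ws') auto
  show ?case
  proof (cases "base x = base x'")
    case True
    from Cons.IH[OF ws'(2)] show ?thesis
    proof (elim disjE exE conjE)
      fix ws1 ws2 assume "xs = ws1 @ ws2" "map base ws1 = map base ws"
      then show ?thesis
        using True ws'(1) by (intro disjI1 exI[of _ "x' # ws1"] exI[of _ ws2]) simp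
    next
      fix zs y rs zs' y' rs'
      assume "ws = zs @ y # rs" "xs = zs' @ y' # rs'" "map base zs = map base zs'" "base y \<noteq> base y'"
      then show ?thesis
        using True ws'(1)
        by (intro disjI2 exI[of _ "x # zs"] exI[of _ y] exI[of _ rs] exI[of _ "x' # zs'"]
            exI[of _ y'] exI[of _ rs']) simp
    qed
  next
    case False
    then show ?thesis
      using ws'(1)
      by (intro disjI2 exI[of _ "[]"] exI[of _ x] exI[of _ ws] exI[of _ "[]"]
            exI[of _ x'] exI[of _ xs]) simp
  qed
qed simp

text \<open>Every letter d of A yields a factor \<open>[base x, d]\<close> of a word in which
  \<open>base x'\<close> is separating; as \<open>base x\<close> differs from it, d must be
  \<open>base x'\<close>.\<close>

lemma sset_two_separating:
  assumes rec: "recurrent A" and tail: "sdrop i (extend_inf (mu_letter x) A) = sdrop i' (extend_inf (mu_letter x') B)"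
    and neq: "base x \<noteq> base x'"
  shows "sset A \<subseteq> {base x'}"
proof
  fix d assume "d \<in> sset A"
  let ?b = "base x" and ?c = "base x'"
  have "factor [d] A" using \<open>d \<in> sset A\<close> by (simp add: factor_singleton)
  then have "factor (lext ?b [d] @ [?b]) (linf ?b A)"
    unfolding factor_def linf_occurs_at by blast
  moreover have lrec: "recurrent (linf ?b A)"
    using recurrent_mu_inf[OF rec, of "[Spin_L ?b]"] by simp
  ultimately have "factor (lext ?b [d] @ [?b]) (sdrop i (extend_inf (mu_letter x) A))"
    unfolding mu_letter_inf_eq_sdrop sdrop_add by (simp only: factor_sdrop_iff)
  then have "factor (lext ?b [d] @ [?b]) (linf ?c B)"
    unfolding tail unfolding mu_letter_inf_eq_sdrop sdrop_add by (rule factor_sdrop)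
  then obtain j where j: "occurs_at (lext ?b [d] @ [?b]) (linf ?c B) j" by (auto simp: factor_def)
  have "prefix [?b, d] (lext ?b [d] @ [?b])" by simp
  then have "occurs_at [?b, d] (linf ?c B) j" using j by (rule occurs_at_prefix)
  then have "linf ?c B !! j = ?b" "linf ?c B !! Suc j = d" unfolding occurs_at_pair by simp_all
  then have "?b = ?c \<or> d = ?c"
    using separating_linf[of ?c B, unfolded separating_def, rule_format, of j] by simp
  then show "d \<in> {base x'}" using neq by simp
qed

lemma lmu_constant: "set w \<subseteq> {c} \<Longrightarrow> lmu w [c] = [c]"
  by (induction w) auto

text \<open>
  The maximal gap between occurrences of \<open>Pal(w)\<close> grows with \<open>w\<close>. If the two directive
  words diverge after a prefix \<open>z\<close>, then they continue as \<open>b c\<^sup>\<omega>\<close> and \<open>c b\<^sup>\<omega>\<close>, and from there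
  on both gaps are the period \<open>|\<mu>\<^sub>z(bc)|\<close>.
\<close>

lemma return_length_le:
  assumes rec: "recurrent T" "recurrent T'" and eq: "mu_inf ws T = mu_inf ws' T'"
    and len: "length ws \<le> length ws'" and d: "d \<in> sset T"
  shows "\<exists>d'\<in>sset T'. length (lmu (map base ws) [d]) \<le> length (lmu (map base ws') [d'])"
  using base_common_prefix[OF len]
proof (elim disjE exE conjE)
  fix ws1 ws2 assume ws': "ws' = ws1 @ ws2" "map base ws1 = map base ws"
  have "mu_inf ws T = mu_inf ws1 (mu_inf ws2 T')" using eq unfolding ws'(1) mu_inf_append .
  then obtain i i' where tail: "sdrop i T = sdrop i' (mu_inf ws2 T')"
    using mu_inf_common_tail[OF _ ws'(2)[symmetric]] by blast
  have "sset T = sset (mu_inf ws2 T')"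
    using sset_sdrop_recurrent[OF rec(1), of i] sset_sdrop_recurrent[OF recurrent_mu_inf[OF rec(2)], of i' ws2]
    unfolding tail by simp
  then show ?thesis
    using return_length_mono[of d ws2 T' "map base ws"] d unfolding ws' map_append by simp
next
  fix zs x rs zs' x' rs'
  assume ws: "ws = zs @ x # rs" "ws' = zs' @ x' # rs'"
    and base: "map base zs = map base zs'" and neq: "base x \<noteq> base x'"
  define A where "A = mu_inf rs T"
  define B where "B = mu_inf rs' T'"
  have "mu_inf zs (extend_inf (mu_letter x) A) = mu_inf zs' (extend_inf (mu_letter x') B)"
    using eq unfolding ws mu_inf_append A_def B_def by simp
  then obtain i i' where tail: "sdrop i (extend_inf (mu_letter x) A) = sdrop i' (extend_inf (mu_letter x') B)"
    using mu_inf_common_tail[OF _ base] by blast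
  have A: "sset A \<subseteq> {base x'}"
    by (rule sset_two_separating[OF _ tail neq]) (simp add: A_def recurrent_mu_inf rec)
  have B: "sset B \<subseteq> {base x}"
    by (rule sset_two_separating[OF _ tail[symmetric] neq[symmetric]]) (simp add: B_def recurrent_mu_inf rec)
  have rs: "set (map base rs) \<subseteq> {base x'}" "d = base x'"
    using A d sset_mu_inf[of rs T] unfolding A_def by blast+
  have 1: "lmu (map base rs) [d] = [base x']" unfolding rs(2) by (rule lmu_constant[OF rs(1)])
  have "shd T' \<in> sset T'" by (rule shd_sset)
  then have rs': "set (map base rs') \<subseteq> {base x}" "shd T' = base x"
    using B sset_mu_inf[of rs' T'] unfolding B_def by blast+
  have 2: "lmu (map base rs') [shd T'] = [base x]" unfolding rs'(2) by (rule lmu_constant[OF rs'(1)])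
  have "lmu (map base ws) [d] = lmu (map base zs) ([base x] @ [base x'])"
    using 1 neq unfolding ws map_append mu_append by simp
  moreover have "lmu (map base ws') [shd T'] = lmu (map base zs) ([base x'] @ [base x])"
    using 2 neq unfolding ws base map_append mu_append by simp
  ultimately have "length (lmu (map base ws) [d]) = length (lmu (map base ws') [shd T'])"
    unfolding mu_append_right by simp
  then show ?thesis using shd_sset by (intro bexI[of _ "shd T'"]) simp_all
qed

section \<open>Minimal decompositions\<close>

lemma decomposition_letters:
  "decomposition t w ws v y ys \<Longrightarrow> set (w @ v) = sset (w @- v @- y)"
  by (auto simp: decomposition_def)

text \<open>q has a decomposition of its own, whose wv is at least as long by minimality; this
  orders the two directive words as \<open>return_length_le\<close> requires. The block of the first
  letter of v is then no longer than some block for q.\<close>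

lemma minimal_decomposition_le:
  assumes epi: "episturmian t" and min: "minimal_decomposition t w ws v y ys"
    and qp: "quasiperiod q t"
  shows "length (mu ws (ipal v)) \<le> length q"
proof -
  have dec: "decomposition t w ws v y ys" using min by (simp add: minimal_decomposition_def)
  obtain w' ws' v' y' ys' p where q: "q = mu ws' (ipal v') @ p"
    and dec': "decomposition t w' ws' v' y' ys'"
    using quasiperiod_decomposition[OF epi qp] by blast
  have len: "length (w @ v) \<le> length (w' @ v')"
    using min dec' decomposition_letters[OF dec'] unfolding minimal_decomposition_def by blast
  obtain T where T: "map base ws = w" "recurrent T" "t = mu_inf (ws @ L_spinned v) T"
    "sset T = sset y" "sset T \<subseteq> set v" using decompositionD[OF dec] .
  obtain T' where T': "map base ws' = w'" "recurrent T'" "t = mu_inf (ws' @ L_spinned v') T'"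
    "sset T' = sset y'" "sset T' \<subseteq> set v'" using decompositionD[OF dec'] .
  have "shd T \<in> sset T" by (rule shd_sset)
  then obtain d v1 where v: "v = d # v1" using T(5) by (cases v) auto
  have "suffix v1 (w @ v)" unfolding v by (intro suffix_appendI suffix_ConsI) simp
  \<comment> \<open>Dropping the first letter d of the shortest suffix v loses a letter of y, and
    that can only be d.\<close>
  then have "set v1 \<noteq> sset (v1 @- y)"
    using min v unfolding minimal_decomposition_def by (metis impossible_Cons)
  then have d: "d \<in> sset T" "d \<notin> set v1" using T(4,5) v by auto
  have "\<exists>d'\<in>sset T'. length (lmu (map base (ws @ L_spinned v)) [d]) \<le>
      length (lmu (map base (ws' @ L_spinned v')) [d'])"
  proof (rule return_length_le[OF T(2) T'(2) _ _ d(1)])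
    show "mu_inf (ws @ L_spinned v) T = mu_inf (ws' @ L_spinned v') T'" using T(3) T'(3) by simp
    show "length (ws @ L_spinned v) \<le> length (ws' @ L_spinned v')"
      using len T(1) T'(1) by auto
  qed
  then obtain d' where d': "d' \<in> sset T'"
    "length (lmu (map base ws @ v) [d]) \<le> length (lmu (map base ws' @ v') [d'])"
    unfolding map_append map_base_L_spinned by (rule bexE)
  have "length (mu ws (ipal v)) \<le> length (lmu (map base ws' @ v') [d'])"
    using d'(2) length_mu_ipal_first[OF d(2), of ws] unfolding v by simp
  also have "\<dots> \<le> length (mu ws' (ipal v'))"
    by (rule length_mu_ipal_ge[OF subsetD[OF T'(5) d'(1)]])
  finally show ?thesis unfolding q by simp
qed

lemma minimal_decomposition_exists:
  assumes "decomposition t w ws v y ys"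
  shows "\<exists>w ws v y ys. minimal_decomposition t w ws v y ys"
proof -
  define N where "N n \<longleftrightarrow> (\<exists>w ws v y ys. decomposition t w ws v y ys \<and> length (w @ v) = n)" for n
  have "N (length (w @ v))" unfolding N_def using assms by blast
  then have least: "N (LEAST n. N n)" by (rule LeastI)
  then obtain w ws v y ys where dec: "decomposition t w ws v y ys"
    and n: "length (w @ v) = (LEAST n. N n)" unfolding N_def by blast
  have least: "length (w @ v) \<le> length (w' @ v')" if "decomposition t w' ws' v' y' ys'" for w' ws' v' y' ys'
  proof -
    have "N (length (w' @ v'))" unfolding N_def using that by blast
    then show ?thesis unfolding n by (rule Least_le)
  qed
  define Q where "Q v' \<longleftrightarrow> suffix v' (w @ v) \<and> set v' = sset (v' @- y)" for v'
  have suf: "suffix v (w @ v)" by (rule suffixI[OF refl])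
  then have "Q v" using dec by (simp add: Q_def decomposition_def)
  define v' where "v' = arg_min length Q"
  have Qv': "Q v'" unfolding v'_def by (rule arg_min_natI[where P = Q, OF \<open>Q v\<close>])
  have short: "length v' \<le> length z" if "Q z" for z
    unfolding v'_def by (rule arg_min_nat_le[where P = Q, OF that])
  have "suffix v' v"
  proof (rule suffix_length_suffix)
    show "suffix v' (w @ v)" using Qv' by (simp add: Q_def)
    show "suffix v (w @ v)" by (rule suf)
    show "length v' \<le> length v" by (rule short[OF \<open>Q v\<close>])
  qed
  then obtain x where x: "v = x @ v'" by (auto simp: suffix_def)
  \<comment> \<open>The surplus x moves from v to w with spin L, which leaves the directive word and
    the length of wv unchanged.\<close>
  have dec': "decomposition t (w @ x) (ws @ L_spinned x) v' y ys"
    using dec Qv' by (simp add: decomposition_def spinned_version_def Q_def x comp_def)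
  have "minimal_decomposition t (w @ x) (ws @ L_spinned x) v' y ys"
    unfolding minimal_decomposition_def
  proof (intro conjI allI impI)
    show "set ((w @ x) @ v') = sset ((w @ x) @- v' @- y)" by (rule decomposition_letters[OF dec'])
    show "length ((w @ x) @ v') \<le> length (w' @ z)"
      if "decomposition t w' ws' z y' ys' \<and> set (w' @ z) = sset (w' @- z @- y')" for w' ws' z y' ys'
      using least[of w' ws' z y' ys'] that by (simp add: x)
    show "length v' \<le> length z" if "suffix z ((w @ x) @ v') \<and> set z = sset (z @- y)" for z
    proof (rule short)
      show "Q z" using that unfolding Q_def x append_assoc .
    qed
  qed (rule dec')
  then show ?thesis by blast
qed

theorem theorem4p19:
  fixes t :: "'a::finite stream"
  assumes "episturmian t"
  shows "{q. quasiperiod q t} =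
           {mu ws (Pal v) @ p | w ws v y ys p.
              decomposition t w ws v y ys \<and>
              prefix p (left_quotient (shifting_factor ws) (Pal w))} \<and>
         (\<forall>q. smallest_quasiperiod q t \<longleftrightarrow>
            (\<exists>w ws v y ys. minimal_decomposition t w ws v y ys \<and> q = mu ws (Pal v)))"
  unfolding Pal_eq_ipal left_quotient_def
proof (intro conjI allI iffI set_eqI)
  fix q assume "q \<in> {q. quasiperiod q t}"
  then show "q \<in> {mu ws (ipal v) @ p | w ws v y ys p.
      decomposition t w ws v y ys \<and> prefix p (drop (length (shifting_factor ws)) (ipal w))}"
    using quasiperiod_decomposition[OF assms, of q] by blast
next
  fix q assume "q \<in> {mu ws (ipal v) @ p | w ws v y ys p.
      decomposition t w ws v y ys \<and> prefix p (drop (length (shifting_factor ws)) (ipal w))}"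
  then obtain w ws v y ys p where q: "q = mu ws (ipal v) @ p" and dec: "decomposition t w ws v y ys"
    "prefix p (drop (length (shifting_factor ws)) (ipal w))" by blast
  show "q \<in> {q. quasiperiod q t}" unfolding q using decomposition_quasiperiod[OF dec] by simp
next
  have qp: "quasiperiod (mu ws (ipal v)) t" if "minimal_decomposition t w ws v y ys" for w ws v y ys
    using decomposition_quasiperiod[of t w ws v y ys "[]"] that
    by (simp add: minimal_decomposition_def)
  {
    fix q assume "\<exists>w ws v y ys. minimal_decomposition t w ws v y ys \<and> q = mu ws (ipal v)"
    then show "smallest_quasiperiod q t"
      using qp minimal_decomposition_le[OF assms] unfolding smallest_quasiperiod_def by blast
  next
    fix q assume q: "smallest_quasiperiod q t"
    then obtain w ws v y ys where min: "minimal_decomposition t w ws v y ys"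
      using quasiperiod_decomposition[OF assms, of q] minimal_decomposition_exists
      unfolding smallest_quasiperiod_def by blast
    have "length (mu ws (ipal v)) \<le> length q"
      using minimal_decomposition_le[OF assms min] q unfolding smallest_quasiperiod_def by blast
    moreover have "length q \<le> length (mu ws (ipal v))"
      using qp[OF min] q unfolding smallest_quasiperiod_def by blast
    ultimately have len: "length q = length (mu ws (ipal v))" by simp
    \<comment> \<open>Quasiperiods are prefixes of t, so equal length means equality.\<close>
    have "occurs_at q t 0" "occurs_at (mu ws (ipal v)) t 0"
      using quasiperiod_prefix[OF qp[OF min]] quasiperiod_prefix[of q t] q
      unfolding smallest_quasiperiod_def by blast+
    then have "q = mu ws (ipal v)" unfolding occurs_at_def len by simp
    then show "\<exists>w ws v y ys. minimal_decomposition t w ws v y ys \<and> q = mu ws (ipal v)"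
      using min by blast
  }
qed

end
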